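(* Let $\|\cdot\|$ be an admissible norm on $\mathbb{R}^3$, let $f:M\to(\mathbb{R}^3,\|\cdot\|)$ be an immersed surface with Birkhoff normal vector field $\eta$, let $p\in M$, and let $\lambda_1\geq\lambda_2$ be the principal curvatures of $M$ at $p$. Then $\lambda_2\leq k_{M,p}(V)\leq\lambda_1$ for every $V\in T_pM\setminus\{0\}$. Moreover, equality holds only in the respective principal directions: if $k_{M,p}(V)=\lambda_i$ ($i\in\{1,2\}$), then $V$ is a principal direction associated to $\lambda_i$.
   Context: Let $B$ and $\partial B$ be the unit ball and unit sphere of $\|\cdot\|$. The norm is admissible if it is smooth ($\partial B$ is locally the graph of a $C^\infty$ function), strictly convex ($\partial B$ contains no line segment), and $\partial B$ has positive Euclidean Gaussian curvature at every point. A non-zero vector $v$ is Birkhoff orthogonal to a 2-dimensional subspace $P$ ($v\dashv_B P$) if the plane through $v/\|v\|$ parallel to $P$ supports $B$; $v\dashv_B w$ means that $w$ lies in the plane $P$ with $v\dashv_B P$. For a smooth immersion of a surface, $M$ is identified with its image and $T_pM$ with the plane $df_p(T_pM)\subset\mathbb{R}^3$. A Birkhoff normal vector field is a (locally defined) smooth map $\eta$ into $\partial B$ with $\eta(p)\dashv_B T_pM$. Since $T_{\eta(p)}\partial B$ and $T_pM$ are the same plane, $d\eta_p$ is a linear endomorphism of $T_pM$, diagonalizable over $\mathbb{R}$; its eigenvalues are the principal curvatures and its eigenvectors the principal directions. Minkowski normal curvature $k_{M,p}(X)$: for $X\in T_pM$ with $\|X\|=1$, let $H=\mathrm{span}\{\eta(p),X\}$,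 oriented so that $(\eta(p),X)$ is a positive basis, and let $\gamma$ be the arc-length (in $\|\cdot\|$) parametrization of the curve $M\cap(p+H)$ near $p$ with $\gamma(0)=p$, $\gamma'(0)=X$. Then $k_{M,p}(X)$ is the circular curvature of $\gamma$ at $p$ in the normed plane $(H,\|\cdot\|)$: if $\varphi(t)$ is the positively oriented arc-length parametrization of the unit circle $\partial B\cap H$, and $\eta_H(s)\in\partial B\cap H$ is the unit vector Birkhoff orthogonal in $H$ to $\gamma'(s)$ with $(\eta_H(s),\gamma'(s))$ positively oriented, write $\eta_H(s)=\varphi(t(s))$ with $\frac{d\varphi}{dt}(t(s))=\gamma'(s)$; the circular curvature at $\gamma(s)$ is $t'(s)$, i.e. $\eta_H'(s)=t'(s)\gamma'(s)$. For general non-zero $X\in T_pM$, $k_{M,p}(X):=k_{M,p}(X/\|X\|)$. *)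

theory Defs
  imports "HOL-Analysis.Analysis"
begin

section \<open>Smooth maps on open sets of Euclidean spaces\<close>

text \<open>Intended for open \<open>S\<close>: the Frechet derivatives are taken in the whole space.\<close>

primrec Ck_on :: "nat \<Rightarrow> 'a::real_normed_vector set \<Rightarrow> ('a \<Rightarrow> 'b::real_normed_vector) \<Rightarrow> bool" where
  "Ck_on 0 S f \<longleftrightarrow> continuous_on S f"
| "Ck_on (Suc k) S f \<longleftrightarrow> (\<forall>x\<in>S. f differentiable (at x)) \<and>
     (\<forall>v. Ck_on k S (\<lambda>x. frechet_derivative f (at x) v))"

definition smooth_on :: "'a::real_normed_vector set \<Rightarrow> ('a \<Rightarrow> 'b::real_normed_vector) \<Rightarrow> bool" where
  "smooth_on S f \<longleftrightarrow> (\<forall>k. Ck_on k S f)"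


section \<open>Admissible norms\<close>

text \<open>The norm is an arbitrary function \<open>N\<close>; the type class norm of \<^typ>\<open>real^3\<close> and its inner
  product are the auxiliary Euclidean structure.\<close>

definition is_norm :: "(real^3 \<Rightarrow> real) \<Rightarrow> bool" where
  "is_norm N \<longleftrightarrow> (\<forall>x. N x = 0 \<longleftrightarrow> x = 0) \<and> (\<forall>a x. N (a *\<^sub>R x) = \<bar>a\<bar> * N x) \<and>
     (\<forall>x y. N (x + y) \<le> N x + N y)"

definition unit_ball :: "(real^3 \<Rightarrow> real) \<Rightarrow> (real^3) set" where
  "unit_ball N = {x. N x \<le> 1}"

definition unit_sphere :: "(real^3 \<Rightarrow> real) \<Rightarrow> (real^3) set" where
  "unit_sphere N = {x. N x = 1}"

text \<open>Near each of its points, \<open>S\<close> is the graph of a smooth function of two variables over some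
  plane; the isometry \<open>T\<close> selects the Euclidean coordinates.\<close>

definition locally_smooth_graph :: "(real^3) set \<Rightarrow> bool" where
  "locally_smooth_graph S \<longleftrightarrow> (\<forall>q\<in>S. \<exists>(T :: real^3 \<Rightarrow> real^3) (U :: (real^2) set) h W.
     orthogonal_transformation T \<and> open U \<and> smooth_on U h \<and> open W \<and> q \<in> W \<and>
     S \<inter> W = (\<lambda>u. T (vector [u$1, u$2, h u])) ` U)"

definition pd :: "(real^2 \<Rightarrow> real^3) \<Rightarrow> 2 \<Rightarrow> real^2 \<Rightarrow> real^3" where
  "pd r i u = frechet_derivative r (at u) (axis i 1)"

text \<open>\<open>(e g - f\<^sup>2) / (E G - F\<^sup>2)\<close> with the coefficients of the second and the first fundamental
  form of the parametrization \<open>r\<close>.\<close>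

definition param_gauss_curvature :: "(real^2 \<Rightarrow> real^3) \<Rightarrow> real^2 \<Rightarrow> real" where
  "param_gauss_curvature r u =
     (let n = sgn (cross3 (pd r 1 u) (pd r 2 u));
          I = (\<lambda>i j. pd r i u \<bullet> pd r j u);
          II = (\<lambda>i j. pd (pd r i) j u \<bullet> n)
      in (II 1 1 * II 2 2 - (II 1 2)\<^sup>2) / (I 1 1 * I 2 2 - (I 1 2)\<^sup>2))"

definition has_gauss_curvature :: "(real^3) set \<Rightarrow> real^3 \<Rightarrow> real \<Rightarrow> bool" where
  "has_gauss_curvature S q K \<longleftrightarrow> (\<exists>r U u. open U \<and> u \<in> U \<and> smooth_on U r \<and>
     (\<forall>v\<in>U. inj (frechet_derivative r (at v))) \<and> r ` U \<subseteq> S \<and> r u = q \<and>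
     K = param_gauss_curvature r u)"

definition admissible_norm :: "(real^3 \<Rightarrow> real) \<Rightarrow> bool" where
  "admissible_norm N \<longleftrightarrow> is_norm N \<and>
     locally_smooth_graph (unit_sphere N) \<and>
     (\<forall>x y. x \<noteq> y \<longrightarrow> \<not> closed_segment x y \<subseteq> unit_sphere N) \<and>
     (\<forall>q\<in>unit_sphere N. \<exists>K>0. has_gauss_curvature (unit_sphere N) q K)"


section \<open>Birkhoff orthogonality\<close>

text \<open>\<open>v\<close> is Birkhoff orthogonal to the hyperplane \<open>P\<close> of the linear space \<open>S\<close>: the translate of
  \<open>P\<close> through \<open>v / N v\<close> supports the unit ball of \<open>(S, N)\<close>, where \<open>n\<close> is a Euclidean
  normal of \<open>P\<close> in \<open>S\<close>. For \<open>S = UNIV\<close> this is orthogonality of a vector to a plane in space; with a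
  plane \<open>S\<close> and a line \<open>P\<close> it is orthogonality in the normed plane \<open>S\<close>.\<close>

definition birkhoff_orthogonal_in ::
  "(real^3 \<Rightarrow> real) \<Rightarrow> (real^3) set \<Rightarrow> real^3 \<Rightarrow> (real^3) set \<Rightarrow> bool" where
  "birkhoff_orthogonal_in N S v P \<longleftrightarrow> v \<in> S \<and> v \<noteq> 0 \<and>
     subspace S \<and> subspace P \<and> P \<subseteq> S \<and> dim S = dim P + 1 \<and>
     (\<exists>n\<in>S. n \<noteq> 0 \<and> (\<forall>y\<in>P. n \<bullet> y = 0) \<and>
        (\<forall>y \<in> unit_ball N \<inter> S. n \<bullet> y \<le> n \<bullet> (v /\<^sub>R N v)))"


section \<open>Immersed surfaces\<close>

text \<open>A smooth surface is a topological space \<open>M\<close> with a smooth atlas \<open>A\<close> of pairs (chart domain,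
  chart map).\<close>

type_synonym 'm atlas = "('m set \<times> ('m \<Rightarrow> real^2)) set"

definition smooth_surface :: "'m topology \<Rightarrow> 'm atlas \<Rightarrow> bool" where
  "smooth_surface M A \<longleftrightarrow> Hausdorff_space M \<and> second_countable M \<and>
     (\<forall>(U, \<psi>)\<in>A. openin M U \<and> open (\<psi> ` U) \<and>
        homeomorphic_map (subtopology M U) (top_of_set (\<psi> ` U)) \<psi>) \<and>
     (\<Union>(U, \<psi>)\<in>A. U) = topspace M \<and>
     (\<forall>(U, \<psi>)\<in>A. \<forall>(V, \<theta>)\<in>A. smooth_on (\<psi> ` (U \<inter> V)) (\<theta> \<circ> inv_into U \<psi>))"

definition smooth_map_on :: "'m atlas \<Rightarrow> 'm set \<Rightarrow> ('m \<Rightarrow> real^3) \<Rightarrow> bool" where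
  "smooth_map_on A W g \<longleftrightarrow> (\<forall>(U, \<psi>)\<in>A. smooth_on (\<psi> ` (U \<inter> W)) (g \<circ> inv_into U \<psi>))"

definition chart_at :: "'m atlas \<Rightarrow> 'm \<Rightarrow> 'm set \<times> ('m \<Rightarrow> real^2)" where
  "chart_at A p = (SOME c. c \<in> A \<and> p \<in> fst c)"

text \<open>The differential of \<open>g\<close> at \<open>p\<close>, with the abstract tangent space at \<open>p\<close> identified with
  \<^typ>\<open>real^2\<close> by one chart around \<open>p\<close>, the same for all maps \<open>g\<close>. The notions derived from it below
  do not depend on the choice of this chart.\<close>

definition differential :: "'m atlas \<Rightarrow> ('m \<Rightarrow> real^3) \<Rightarrow> 'm \<Rightarrow> real^2 \<Rightarrow> real^3" where
  "differential A g p =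
     (case chart_at A p of (U, \<psi>) \<Rightarrow> frechet_derivative (g \<circ> inv_into U \<psi>) (at (\<psi> p)))"

definition immersed_surface :: "'m topology \<Rightarrow> 'm atlas \<Rightarrow> ('m \<Rightarrow> real^3) \<Rightarrow> bool" where
  "immersed_surface M A f \<longleftrightarrow> smooth_surface M A \<and> smooth_map_on A (topspace M) f \<and>
     (\<forall>p\<in>topspace M. inj (differential A f p))"

definition tangent_plane :: "'m atlas \<Rightarrow> ('m \<Rightarrow> real^3) \<Rightarrow> 'm \<Rightarrow> (real^3) set" where
  "tangent_plane A f p = range (differential A f p)"

definition birkhoff_normal_field :: "(real^3 \<Rightarrow> real) \<Rightarrow> 'm topology \<Rightarrow> 'm atlas \<Rightarrow>
    ('m \<Rightarrow> real^3) \<Rightarrow> 'm set \<Rightarrow> ('m \<Rightarrow> real^3) \<Rightarrow> bool" where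
  "birkhoff_normal_field N M A f W \<eta> \<longleftrightarrow> openin M W \<and> smooth_map_on A W \<eta> \<and>
     (\<forall>q\<in>W. \<eta> q \<in> unit_sphere N \<and> birkhoff_orthogonal_in N UNIV (\<eta> q) (tangent_plane A f q))"

text \<open>\<open>d\<eta>\<^sub>p\<close> as an endomorphism of the tangent plane in space; meaningful on
  \<^term>\<open>tangent_plane A f p\<close> only.\<close>

definition shape_operator ::
  "'m atlas \<Rightarrow> ('m \<Rightarrow> real^3) \<Rightarrow> ('m \<Rightarrow> real^3) \<Rightarrow> 'm \<Rightarrow> real^3 \<Rightarrow> real^3" where
  "shape_operator A f \<eta> p w = differential A \<eta> p (inv (differential A f p) w)"

definition principal_direction ::
  "'m atlas \<Rightarrow> ('m \<Rightarrow> real^3) \<Rightarrow> ('m \<Rightarrow> real^3) \<Rightarrow> 'm \<Rightarrow> real \<Rightarrow> real^3 \<Rightarrow> bool" where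
  "principal_direction A f \<eta> p l w \<longleftrightarrow>
     w \<in> tangent_plane A f p \<and> w \<noteq> 0 \<and> shape_operator A f \<eta> p w = l *\<^sub>R w"

definition principal_curvatures ::
  "'m atlas \<Rightarrow> ('m \<Rightarrow> real^3) \<Rightarrow> ('m \<Rightarrow> real^3) \<Rightarrow> 'm \<Rightarrow> real set" where
  "principal_curvatures A f \<eta> p = {l. \<exists>w. principal_direction A f \<eta> p l w}"


section \<open>Circular curvature in a normed plane\<close>

text \<open>\<open>(x, y)\<close> is a positive basis of the plane \<open>span {a, b}\<close> oriented by the basis \<open>(a, b)\<close>.\<close>

definition pos_oriented :: "real^3 \<Rightarrow> real^3 \<Rightarrow> real^3 \<Rightarrow> real^3 \<Rightarrow> bool" where
  "pos_oriented a b x y \<longleftrightarrow> (\<exists>x1 x2 y1 y2. x = x1 *\<^sub>R a + x2 *\<^sub>R b \<and> y = y1 *\<^sub>R a + y2 *\<^sub>R b \<and>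
     x1 * y2 - x2 * y1 > 0)"

text \<open>Only \<open>C\<^sup>1\<close> is required: a curve of unit speed in a smooth one-dimensional submanifold, as all
  curves below, is then smooth.\<close>

definition arc_length_on :: "(real^3 \<Rightarrow> real) \<Rightarrow> real set \<Rightarrow> (real \<Rightarrow> real^3) \<Rightarrow> bool" where
  "arc_length_on N J \<gamma> \<longleftrightarrow>
     \<gamma> C1_differentiable_on J \<and> (\<forall>s\<in>J. N (vector_derivative \<gamma> (at s)) = 1)"

definition unit_circle_param ::
  "(real^3 \<Rightarrow> real) \<Rightarrow> real^3 \<Rightarrow> real^3 \<Rightarrow> (real \<Rightarrow> real^3) \<Rightarrow> bool" where
  "unit_circle_param N a b \<phi> \<longleftrightarrow> arc_length_on N UNIV \<phi> \<and>
     range \<phi> = unit_sphere N \<inter> span {a, b} \<and>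
     (\<forall>t. pos_oriented a b (\<phi> t) (vector_derivative \<phi> (at t)))"

text \<open>The curve \<open>\<gamma>\<close>, parametrized by arc length near \<open>s\<close>, has circular curvature \<open>\<kappa>\<close> at \<open>\<gamma> s\<close> in the
  plane \<open>span {a, b}\<close> with norm \<open>N\<close> and the orientation of \<open>(a, b)\<close>.\<close>

definition has_circular_curvature ::
  "(real^3 \<Rightarrow> real) \<Rightarrow> real^3 \<Rightarrow> real^3 \<Rightarrow> (real \<Rightarrow> real^3) \<Rightarrow> real \<Rightarrow> real \<Rightarrow> bool" where
  "has_circular_curvature N a b \<gamma> s \<kappa> \<longleftrightarrow> (\<exists>\<phi> \<nu> t. unit_circle_param N a b \<phi> \<and>
     (\<forall>\<^sub>F r in nhds s.
        \<nu> r \<in> unit_sphere N \<inter> span {a, b} \<and>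
        birkhoff_orthogonal_in N (span {a, b}) (\<nu> r) (span {vector_derivative \<gamma> (at r)}) \<and>
        pos_oriented a b (\<nu> r) (vector_derivative \<gamma> (at r)) \<and>
        \<nu> r = \<phi> (t r) \<and> vector_derivative \<phi> (at (t r)) = vector_derivative \<gamma> (at r)) \<and>
     (t has_real_derivative \<kappa>) (at s))"


section \<open>Minkowski normal curvature\<close>

text \<open>\<open>\<gamma>\<close> is the arc-length parametrization with \<open>\<gamma> 0 = f p\<close>, \<open>\<gamma>' 0 = X\<close> of the intersection of the
  surface near \<open>p\<close> with \<open>f p + span {\<eta> p, X}\<close>. As \<open>f\<close> need not be injective, the intersection is
  taken in \<open>M\<close>, where \<open>c\<close> is the lift of \<open>\<gamma>\<close>.\<close>

definition normal_section :: "(real^3 \<Rightarrow> real) \<Rightarrow> 'm topology \<Rightarrow> ('m \<Rightarrow> real^3) \<Rightarrow>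
    ('m \<Rightarrow> real^3) \<Rightarrow> 'm \<Rightarrow> real^3 \<Rightarrow> (real \<Rightarrow> real^3) \<Rightarrow> bool" where
  "normal_section N M f \<eta> p X \<gamma> \<longleftrightarrow> (\<exists>\<epsilon>>0. \<exists>W c. openin M W \<and> p \<in> W \<and>
     continuous_map (top_of_set {-\<epsilon><..<\<epsilon>}) M c \<and> c 0 = p \<and>
     c ` {-\<epsilon><..<\<epsilon>} = {q\<in>W. f q - f p \<in> span {\<eta> p, X}} \<and>
     (\<forall>s\<in>{-\<epsilon><..<\<epsilon>}. \<gamma> s = f (c s)) \<and>
     arc_length_on N {-\<epsilon><..<\<epsilon>} \<gamma> \<and> vector_derivative \<gamma> (at 0) = X)"

definition normal_curvature :: "(real^3 \<Rightarrow> real) \<Rightarrow> 'm topology \<Rightarrow> ('m \<Rightarrow> real^3) \<Rightarrow>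
    ('m \<Rightarrow> real^3) \<Rightarrow> 'm \<Rightarrow> real^3 \<Rightarrow> real" where
  "normal_curvature N M f \<eta> p V = (let X = V /\<^sub>R N V in
     THE k. \<exists>\<gamma>. normal_section N M f \<eta> p X \<gamma> \<and> has_circular_curvature N (\<eta> p) X \<gamma> 0 k)"

end

theory Submission
  imports Defs
begin

text \<open>
  The normal curvature is a Rayleigh quotient of the shape operator \<open>d\<eta>\<^sub>p\<close>, and the bounds with
  their equality cases are those of Rayleigh quotients.

  Let \<open>n\<close> be the gradient of the norm: \<open>n x\<close> is a Euclidean normal of the unit sphere at \<open>x\<close>,
  normalized by \<open>n x \<bullet> x = N x\<close>. Its derivative \<open>n'\<close> gives the form
  \<open>b(Y, Z) = n' (\<eta> p) Y \<bullet> Z\<close> on the tangent plane, which is a second fundamental form of the unit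
  sphere: it is symmetric, nonnegative by convexity, and its determinant is positive by the assumption
  on the Gaussian curvature, so it is an inner product (\<open>n'_symmetric_definite\<close>). Differentiating
  \<open>n (\<eta> q) \<bullet> df\<^sub>q w = 0\<close> shows that \<open>b(d\<eta>\<^sub>p Y, Z)\<close> is a second derivative of \<open>f\<close> and thus
  symmetric (\<open>shape_symmetric\<close>): the shape operator is self-adjoint with respect to \<open>b\<close>.

  Along a normal section \<open>\<gamma>\<close> with \<open>\<gamma>' 0 = X\<close>, the tangent \<open>\<gamma>' s\<close> is annihilated by the normal
  \<open>n (\<eta> (c s))\<close> of the surface and, by definition of the circular curvature \<open>k\<close>, also by the normal
  \<open>n (\<phi> (t s))\<close> of the unit circle of the normal plane. Both normals agree at \<open>s = 0\<close>, where strict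
  convexity gives \<open>\<phi> (t 0) = \<eta> p\<close>; comparing them to first order yields
  \<open>k * b(X, X) = b(d\<eta>\<^sub>p X, X)\<close> (\<open>circular_curvature_determined\<close>).

  As the normal curvature is defined by a description, one also has to produce a normal section and
  its circular curvature. Projecting along \<open>\<eta> p\<close> turns the surface near \<open>p\<close> into a graph over its tangent
  plane, by the inverse function theorem; the normal section is then the part of the graph over a line
  (\<open>section_curve\<close>). Its circular curvature exists because the slope of \<open>n\<close> along the unit circle has a
  positive derivative and can be inverted (\<open>circular_curvature_exists\<close>).
\<close>

section \<open>Second derivatives of smooth maps\<close>

lemma smooth_on_has_derivative:
  assumes "smooth_on S f" "x \<in> S"
  shows "(f has_derivative frechet_derivative f (at x)) (at x)"
proof -
  have "Ck_on 1 S f" using assms by (simp only: smooth_on_def)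
  then show ?thesis using assms(2) frechet_derivative_works by auto
qed

lemma smooth_on_frechet_derivative:
  assumes "smooth_on S f"
  shows "smooth_on S (\<lambda>x. frechet_derivative f (at x) v)"
  unfolding smooth_on_def
proof
  fix k
  have "Ck_on (Suc k) S f" using assms by (simp only: smooth_on_def)
  then show "Ck_on k S (\<lambda>x. frechet_derivative f (at x) v)" by simp
qed

lemma smooth_on_imp_continuous_on:
  assumes "smooth_on S f"
  shows "continuous_on S f"
proof -
  have "Ck_on 0 S f" using assms by (simp only: smooth_on_def)
  then show ?thesis by simp
qed

lemma has_derivative_along_line:
  assumes "(f has_derivative D) (at (a + s *\<^sub>R v))"
  shows "((\<lambda>t. f (a + t *\<^sub>R v)) has_vector_derivative D v) (at s)"
proof -
  have 1: "((\<lambda>t. a + t *\<^sub>R v) has_vector_derivative v) (at s)"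
    by (auto intro!: derivative_eq_intros simp: has_vector_derivative_def)
  show ?thesis
    using vector_derivative_diff_chain_within[OF 1, of f D] assms
    by (simp add: o_def has_derivative_at_withinI)
qed

text \<open>A second difference quotient is a value of a mixed second derivative: the mean value theorem
  is applied to one variable, then to the other.\<close>

lemma second_difference_mean_value:
  fixes f :: "'a::real_normed_vector \<Rightarrow> real"
  assumes h: "h > 0"
    and sub: "\<And>s t. 0 \<le> s \<Longrightarrow> s \<le> h \<Longrightarrow> 0 \<le> t \<Longrightarrow> t \<le> h \<Longrightarrow> x + s *\<^sub>R v + t *\<^sub>R w \<in> S"
    and D1: "\<And>y. y \<in> S \<Longrightarrow> (f has_derivative D y) (at y)"
    and D2: "\<And>y. y \<in> S \<Longrightarrow> ((\<lambda>y. D y v) has_derivative E y) (at y)"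
  shows "\<exists>s t. 0 < s \<and> s < h \<and> 0 < t \<and> t < h \<and>
    f (x + h *\<^sub>R v + h *\<^sub>R w) - f (x + h *\<^sub>R v) - f (x + h *\<^sub>R w) + f x
      = h * h * E (x + s *\<^sub>R v + t *\<^sub>R w) w"
proof -
  have "\<exists>s>0. s < h \<and> (f (x + h *\<^sub>R v + h *\<^sub>R w) - f (x + h *\<^sub>R v + 0 *\<^sub>R w))
      - (f (x + 0 *\<^sub>R v + h *\<^sub>R w) - f (x + 0 *\<^sub>R v + 0 *\<^sub>R w))
      = (h - 0) * (D (x + s *\<^sub>R v + h *\<^sub>R w) v - D (x + s *\<^sub>R v + 0 *\<^sub>R w) v)"
  proof (rule MVT2)
    fix s assume s: "0 \<le> s" "s \<le> h"
    have *: "((\<lambda>s. f (x + s *\<^sub>R v + t *\<^sub>R w)) has_real_derivative D (x + s *\<^sub>R v + t *\<^sub>R w) v) (at s)"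
      if "0 \<le> t" "t \<le> h" for t
      using has_derivative_along_line[of f "D (x + s *\<^sub>R v + t *\<^sub>R w)" "x + t *\<^sub>R w" s v]
        D1[OF sub[OF s that]]
      by (simp add: algebra_simps has_real_derivative_iff_has_vector_derivative)
    show "((\<lambda>s. f (x + s *\<^sub>R v + h *\<^sub>R w) - f (x + s *\<^sub>R v + 0 *\<^sub>R w)) has_real_derivative
        D (x + s *\<^sub>R v + h *\<^sub>R w) v - D (x + s *\<^sub>R v + 0 *\<^sub>R w) v) (at s)"
      using h by (intro DERIV_diff *) auto
  qed (use h in auto)
  then obtain s where s: "0 < s" "s < h"
    "f (x + h *\<^sub>R v + h *\<^sub>R w) - f (x + h *\<^sub>R v) - f (x + h *\<^sub>R w) + f x
      = h * (D (x + s *\<^sub>R v + h *\<^sub>R w) v - D (x + s *\<^sub>R v + 0 *\<^sub>R w) v)"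
    by (auto simp: algebra_simps)
  have "\<exists>t>0. t < h \<and> D (x + s *\<^sub>R v + h *\<^sub>R w) v - D (x + s *\<^sub>R v + 0 *\<^sub>R w) v
      = (h - 0) * E (x + s *\<^sub>R v + t *\<^sub>R w) w"
  proof (rule MVT2)
    fix t assume t: "0 \<le> t" "t \<le> h"
    show "((\<lambda>t. D (x + s *\<^sub>R v + t *\<^sub>R w) v) has_real_derivative E (x + s *\<^sub>R v + t *\<^sub>R w) w) (at t)"
      using has_derivative_along_line[of "\<lambda>y. D y v" "E (x + s *\<^sub>R v + t *\<^sub>R w)" "x + s *\<^sub>R v" t w]
        D2[OF sub[of s t]] s t
      by (simp add: has_real_derivative_iff_has_vector_derivative)
  qed (use h in auto)
  then show ?thesis using s by (metis diff_zero mult.assoc)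
qed

text \<open>The second difference is symmetric in the two directions, so both mixed derivatives take a common
  value arbitrarily close to \<open>x\<close>.\<close>

lemma second_derivative_symmetric_real:
  fixes f :: "'a::real_normed_vector \<Rightarrow> real"
  assumes S: "open S" "x \<in> S"
    and D: "\<And>y. y \<in> S \<Longrightarrow> (f has_derivative D y) (at y)"
    and E: "\<And>y v. y \<in> S \<Longrightarrow> ((\<lambda>y. D y v) has_derivative E v y) (at y)"
    and cont: "\<And>v w. continuous_on S (\<lambda>y. E v y w)"
  shows "E v x w = E w x v"
proof (rule ccontr)
  assume ne: "E v x w \<noteq> E w x v"
  define e where "e = \<bar>E v x w - E w x v\<bar> / 2"
  have e: "e > 0" using ne by (simp add: e_def)
  obtain r where r: "r > 0" "ball x r \<subseteq> S" using S open_contains_ball by blast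
  have cl: "\<exists>d>0. \<forall>y\<in>S. dist y x < d \<longrightarrow> dist (E a y b) (E a x b) < e" for a b
    using cont[of a b] S(2) e unfolding continuous_on_iff by blast
  obtain d1 where d1: "d1 > 0" "\<And>y. y \<in> S \<Longrightarrow> dist y x < d1 \<Longrightarrow> dist (E v y w) (E v x w) < e"
    using cl[of v w] by blast
  obtain d2 where d2: "d2 > 0" "\<And>y. y \<in> S \<Longrightarrow> dist y x < d2 \<Longrightarrow> dist (E w y v) (E w x v) < e"
    using cl[of w v] by blast
  define d where "d = min r (min d1 d2)"
  have d: "d > 0" using r d1 d2 by (simp add: d_def)
  define h where "h = d / (2 * (norm v + norm w + 1))"
  have pos: "norm v + norm w + 1 > 0" by (smt (verit) norm_ge_zero)
  have h: "h > 0" using d pos by (simp add: h_def)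
  have close: "dist (x + s *\<^sub>R v + t *\<^sub>R w) x < d" if "0 \<le> s" "s \<le> h" "0 \<le> t" "t \<le> h" for s t
  proof -
    have "norm (s *\<^sub>R v + t *\<^sub>R w) \<le> s * norm v + t * norm w"
      using norm_triangle_ineq[of "s *\<^sub>R v" "t *\<^sub>R w"] that by simp
    also have "\<dots> \<le> h * norm v + h * norm w"
      using that by (intro add_mono mult_right_mono) auto
    also have "\<dots> \<le> h * (norm v + norm w + 1)" using h by (simp add: algebra_simps)
    also have "\<dots> = d / 2" using pos unfolding h_def by (simp add: divide_simps)
    also have "\<dots> < d" using d by simp
    finally show ?thesis by (simp add: dist_norm algebra_simps)
  qed
  have inS: "x + s *\<^sub>R v + t *\<^sub>R w \<in> S" if "0 \<le> s" "s \<le> h" "0 \<le> t" "t \<le> h" for s t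
    using close[OF that] r by (auto simp: d_def dist_commute subset_iff)
  obtain s t where st: "0 < s" "s < h" "0 < t" "t < h" and
    "f (x + h *\<^sub>R v + h *\<^sub>R w) - f (x + h *\<^sub>R v) - f (x + h *\<^sub>R w) + f x
      = h * h * E v (x + s *\<^sub>R v + t *\<^sub>R w) w"
    using second_difference_mean_value[of h x v w S f D "E v", OF h inS D E] by blast
  moreover obtain s' t' where st': "0 < s'" "s' < h" "0 < t'" "t' < h" and
    "f (x + h *\<^sub>R w + h *\<^sub>R v) - f (x + h *\<^sub>R w) - f (x + h *\<^sub>R v) + f x
      = h * h * E w (x + s' *\<^sub>R w + t' *\<^sub>R v) v"
  proof -
    have "x + s *\<^sub>R w + t *\<^sub>R v \<in> S" if "0 \<le> s" "s \<le> h" "0 \<le> t" "t \<le> h" for s t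
      using inS[OF that(3,4,1,2)] by (simp add: algebra_simps)
    from second_difference_mean_value[of h x w v S f D "E w", OF h this D E] that show ?thesis
      by blast
  qed
  ultimately have "h * h * E v (x + s *\<^sub>R v + t *\<^sub>R w) w = h * h * E w (x + s' *\<^sub>R w + t' *\<^sub>R v) v"
    by (simp add: algebra_simps)
  then have "E v (x + s *\<^sub>R v + t *\<^sub>R w) w = E w (x + s' *\<^sub>R w + t' *\<^sub>R v) v" using h by simp
  moreover have "dist (E v (x + s *\<^sub>R v + t *\<^sub>R w) w) (E v x w) < e"
    using d1(2)[OF inS[of s t]] close[of s t] st by (simp add: d_def)
  moreover have "dist (E w (x + s' *\<^sub>R w + t' *\<^sub>R v) v) (E w x v) < e"
    using d2(2)[OF inS[of t' s']] close[of t' s'] st' by (simp add: d_def algebra_simps)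
  ultimately show False unfolding dist_real_def e_def by (smt (verit) field_sum_of_halves)
qed

lemma second_derivative_symmetric:
  fixes f :: "'a::real_normed_vector \<Rightarrow> 'b::real_inner"
  assumes f: "smooth_on S f" and S: "open S" "x \<in> S"
  shows "frechet_derivative (\<lambda>y. frechet_derivative f (at y) v) (at x) w
       = frechet_derivative (\<lambda>y. frechet_derivative f (at y) w) (at x) v" (is "?E v w = ?E w v")
proof -
  have "?E v w \<bullet> z = ?E w v \<bullet> z" for z
  proof (rule second_derivative_symmetric_real[where f = "\<lambda>y. f y \<bullet> z" and S = S
      and D = "\<lambda>y v. frechet_derivative f (at y) v \<bullet> z"
      and E = "\<lambda>v y w. frechet_derivative (\<lambda>y. frechet_derivative f (at y) v) (at y) w \<bullet> z"])
    show "((\<lambda>y. f y \<bullet> z) has_derivative (\<lambda>v. frechet_derivative f (at y) v \<bullet> z)) (at y)"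
      if "y \<in> S" for y
      by (rule has_derivative_inner_left) (rule smooth_on_has_derivative[OF f that])
    show "((\<lambda>y. frechet_derivative f (at y) v \<bullet> z) has_derivative
       (\<lambda>w. frechet_derivative (\<lambda>y. frechet_derivative f (at y) v) (at y) w \<bullet> z)) (at y)"
      if "y \<in> S" for y v
      by (rule has_derivative_inner_left)
        (rule smooth_on_has_derivative[OF smooth_on_frechet_derivative[OF f] that])
    show "continuous_on S
        (\<lambda>y. frechet_derivative (\<lambda>y. frechet_derivative f (at y) v) (at y) w \<bullet> z)" for v w
      by (intro continuous_intros smooth_on_imp_continuous_on smooth_on_frechet_derivative f)
  qed (use S in auto)
  then show ?thesis using vector_eq_rdot by blast
qed

section \<open>The gradient of an admissible norm\<close>

definition supports :: "(real^3 \<Rightarrow> real) \<Rightarrow> real^3 \<Rightarrow> real^3 \<Rightarrow> bool" where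
  "supports N m x \<longleftrightarrow> m \<bullet> x = N x \<and> (\<forall>y. m \<bullet> y \<le> N y)"

lemma is_norm_zero [simp]: "is_norm N \<Longrightarrow> N 0 = 0"
  by (simp add: is_norm_def)

lemma is_norm_scaleR: "is_norm N \<Longrightarrow> N (a *\<^sub>R x) = \<bar>a\<bar> * N x"
  by (simp add: is_norm_def)

lemma is_norm_triangle: "is_norm N \<Longrightarrow> N (x + y) \<le> N x + N y"
  by (simp add: is_norm_def)

lemma is_norm_pos: "is_norm N \<Longrightarrow> x \<noteq> 0 \<Longrightarrow> N x > 0"
proof -
  assume N: "is_norm N" and x: "x \<noteq> 0"
  have "N (x + (-1) *\<^sub>R x) \<le> N x + N ((-1) *\<^sub>R x)" using N by (rule is_norm_triangle)
  then have "0 \<le> N x" using N is_norm_scaleR[OF N, of "-1" x] by simp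
  then show ?thesis using N x by (metis is_norm_def less_eq_real_def)
qed

lemma is_norm_normalize: "is_norm N \<Longrightarrow> x \<noteq> 0 \<Longrightarrow> N (x /\<^sub>R N x) = 1"
  using is_norm_pos[of N x] by (simp add: is_norm_scaleR)

lemma is_norm_continuous: "is_norm N \<Longrightarrow> continuous_on A N"
proof -
  assume N: "is_norm N"
  have "convex_on UNIV N"
  proof (rule convex_onI)
    fix t x y assume "0 < t" "t < (1::real)"
    then show "N ((1 - t) *\<^sub>R x + t *\<^sub>R y) \<le> (1 - t) * N x + t * N y"
      using is_norm_triangle[OF N, of "(1 - t) *\<^sub>R x" "t *\<^sub>R y"] by (simp add: is_norm_scaleR[OF N])
  qed simp
  then show ?thesis using convex_on_continuous continuous_on_subset by blast
qed

text \<open>Separate \<open>x\<close> from the convex set of all vectors of smaller norm.\<close>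

lemma supporting_functional_exists:
  assumes N: "is_norm N" and x: "x \<noteq> 0"
  shows "\<exists>m. supports N m x"
proof -
  have Nx: "N x > 0" using assms by (rule is_norm_pos)
  have "convex {y. N y < N x}"
  proof (rule convexI)
    fix y z u v assume yz: "y \<in> {y. N y < N x}" "z \<in> {y. N y < N x}"
      and uv: "(0::real) \<le> u" "0 \<le> v" "u + v = 1"
    have "N (u *\<^sub>R y + v *\<^sub>R z) \<le> u * N y + v * N z"
      using is_norm_triangle[OF N, of "u *\<^sub>R y" "v *\<^sub>R z"] uv by (simp add: is_norm_scaleR[OF N])
    also have "\<dots> < N x"
      using yz uv by (intro convex_bound_lt) auto
    finally show "u *\<^sub>R y + v *\<^sub>R z \<in> {y. N y < N x}" by simp
  qed
  moreover have "{y. N y < N x} \<inter> {x} = {}" by simp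
  moreover have "{y. N y < N x} \<noteq> {}" using Nx N by (metis empty_iff mem_Collect_eq is_norm_zero)
  ultimately obtain a b where a: "a \<noteq> 0" "\<And>y. N y < N x \<Longrightarrow> a \<bullet> y \<le> b" "a \<bullet> x \<ge> b"
    using separating_hyperplane_sets[of "{y. N y < N x}" "{x}"] by auto
  have le: "a \<bullet> y \<le> a \<bullet> x" if "N y < N x" for y using a that by force
  define s where "s = N x / (2 * N a)"
  have Na: "N a > 0" using N a(1) by (rule is_norm_pos)
  have s: "s > 0" using Na Nx by (simp add: s_def)
  have "N (s *\<^sub>R a) < N x" using s Nx Na by (simp add: is_norm_scaleR[OF N] s_def)
  then have "s * (a \<bullet> a) \<le> a \<bullet> x" using le by fastforce
  then have ax: "a \<bullet> x > 0" using s a(1) by (smt (verit) inner_gt_zero_iff mult_pos_pos)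
  have bound: "a \<bullet> y * N x \<le> N y * (a \<bullet> x)" for y
  proof (rule field_le_epsilon)
    fix e :: real assume e: "e > 0"
    define t where "t = N y + e / (a \<bullet> x)"
    have Ny: "N y \<ge> 0" using is_norm_pos[OF N, of y] N by (cases "y = 0") auto
    have t: "t > N y" using e ax by (simp add: t_def)
    then have t0: "t > 0" using Ny by simp
    have "N ((N x / t) *\<^sub>R y) = N x * N y / t" using Nx t0 by (simp add: is_norm_scaleR[OF N])
    also have "\<dots> < N x" using t t0 Nx by (simp add: divide_simps)
    finally have "a \<bullet> ((N x / t) *\<^sub>R y) \<le> a \<bullet> x" by (rule le)
    then have "a \<bullet> y * N x \<le> t * (a \<bullet> x)" using t0 by (simp add: divide_simps mult.commute)
    also have "\<dots> = N y * (a \<bullet> x) + e" using ax by (simp add: t_def field_simps)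
    finally show "a \<bullet> y * N x \<le> N y * (a \<bullet> x) + e" .
  qed
  have "supports N ((N x / (a \<bullet> x)) *\<^sub>R a) x"
    using bound ax by (simp add: supports_def divide_simps mult.commute)
  then show ?thesis ..
qed

lemma supports_scaleR:
  assumes "is_norm N" "c > 0"
  shows "supports N m (c *\<^sub>R x) \<longleftrightarrow> supports N m x"
  using assms by (simp add: supports_def is_norm_scaleR)

lemma vector_3_eq_axis: "(vector [a, b, c] :: real^3) = a *\<^sub>R axis 1 1 + b *\<^sub>R axis 2 1 + c *\<^sub>R axis 3 1"
  by (simp add: vec_eq_iff forall_3 axis_def)

lemma vector_2_eq_axis: "(vector [a, b] :: real^2) = a *\<^sub>R axis 1 1 + b *\<^sub>R axis 2 1"
  by (simp add: vec_eq_iff forall_2 axis_def)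

text \<open>A functional that supports the ball at a point of a smooth graph has a critical point on the graph,
  hence is a multiple of the normal \<open>(- \<partial>\<^sub>1 h, - \<partial>\<^sub>2 h, 1)\<close>, and its value \<open>1\<close> at the point fixes the
  multiple. So on the sphere the supporting functional is unique and depends differentiably on the
  point.\<close>

lemma graph_supporting_functional:
  assumes N: "is_norm N" and G: "locally_smooth_graph (unit_sphere N)" and q: "N q = 1"
  obtains Z g where "open Z" "q \<in> Z"
    "\<And>x. x \<in> Z \<Longrightarrow> N x = 1 \<Longrightarrow> g differentiable (at x)"
    "\<And>x m. x \<in> Z \<Longrightarrow> N x = 1 \<Longrightarrow> supports N m x \<Longrightarrow> m = g x"
proof -
  obtain T :: "real^3 \<Rightarrow> real^3" and U :: "(real^2) set" and h W where
    T: "orthogonal_transformation T" and U: "open U" and h: "smooth_on U h" and W: "open W" "q \<in> W"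
    and SW: "unit_sphere N \<inter> W = (\<lambda>u. T (vector [u$1, u$2, h u])) ` U"
    using G q unfolding locally_smooth_graph_def unit_sphere_def by blast
  define T' where "T' = inv T"
  have T': "orthogonal_transformation T'" unfolding T'_def using T by (rule orthogonal_transformation_inv)
  have TT': "T (T' z) = z" "T' (T z) = z" for z
    using T T'_def by (simp_all add: bij_is_surj orthogonal_transformation_bij surj_f_inv_f
        orthogonal_transformation_inj inv_f_f)
  have inn: "m \<bullet> T z = T' m \<bullet> z" for m z
    using T TT'(1)[of m] unfolding orthogonal_transformation_def by metis
  have bl: "bounded_linear T" "bounded_linear T'"
    using T T' linear_conv_bounded_linear orthogonal_transformation_linear by blast+
  define pr :: "real^3 \<Rightarrow> real^2" where "pr x = vector [T' x $ 1, T' x $ 2]" for x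
  define R :: "real^2 \<Rightarrow> real^3" where "R u = T (vector [u$1, u$2, h u])" for u
  define d where "d i u = frechet_derivative h (at u) (axis i 1)" for i :: 2 and u
  define g0 where "g0 x = T (vector [- d 1 (pr x), - d 2 (pr x), 1])" for x
  have pr_lin: "bounded_linear pr"
    unfolding pr_def vector_2_eq_axis
    by (intro bounded_linear_add bounded_linear_compose[OF bounded_linear_scaleR_left]
        bounded_linear_compose[OF bounded_linear_vec_nth] bl)
  define Z where "Z = W \<inter> pr -` U"
  have "open (pr -` U)" using U linear_continuous_on[OF pr_lin]
    by (rule open_vimage)
  then have Z: "open Z" using W unfolding Z_def by (intro open_Int) auto
  have prR: "pr (R u) = u" for u
    by (simp add: pr_def R_def TT' vec_eq_iff forall_2)
  have SZ: "\<exists>u\<in>U. x = R u" if "x \<in> W" "N x = 1" for x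
    using SW that unfolding unit_sphere_def R_def by auto
  have qZ: "q \<in> Z" using SZ[OF W(2) q] W(2) by (auto simp: Z_def prR)
  have sup: "\<exists>c. m = c *\<^sub>R g0 x" if x: "x \<in> Z" "N x = 1" and m: "supports N m x" for x m
  proof -
    obtain u where u: "u \<in> U" "x = R u" using SZ x by (auto simp: Z_def)
    have RS: "N (R v) = 1" if "v \<in> U" for v
      using SW that unfolding unit_sphere_def R_def by blast
    have D: "((\<lambda>u. m \<bullet> R u) has_derivative
        (\<lambda>v. m \<bullet> T (vector [v$1, v$2, frechet_derivative h (at u) v]))) (at u)"
      unfolding R_def vector_3_eq_axis
      by (rule has_derivative_inner_right, rule bounded_linear.has_derivative[OF bl(1)])
        (auto intro!: derivative_eq_intros smooth_on_has_derivative[OF h u(1)]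
          bounded_linear.has_derivative[OF bounded_linear_vec_nth])
    have "(\<lambda>v. m \<bullet> T (vector [v$1, v$2, frechet_derivative h (at u) v])) = (\<lambda>v. 0)"
    proof (rule differential_zero_maxmin[OF u(1) U D])
      show "(\<forall>v\<in>U. m \<bullet> R v \<le> m \<bullet> R u) \<or> (\<forall>v\<in>U. m \<bullet> R u \<le> m \<bullet> R v)"
        using m RS x u unfolding supports_def by metis
    qed
    then have "T' m \<bullet> vector [v$1, v$2, frechet_derivative h (at u) v] = 0" for v
      unfolding inn by (rule fun_cong)
    then have *: "T' m $ 1 * v$1 + T' m $ 2 * v$2 + T' m $ 3 * frechet_derivative h (at u) v = 0" for v
      by (simp add: inner_vec_def sum_3)
    have "T' m = T' m $ 3 *\<^sub>R vector [- d 1 u, - d 2 u, 1]"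
      using *[of "axis 1 1"] *[of "axis 2 1"]
      by (simp add: vec_eq_iff forall_3 d_def) (simp add: axis_def)
    then have "m = T (T' m $ 3 *\<^sub>R vector [- d 1 u, - d 2 u, 1])" using TT'(1) by metis
    then have "m = T' m $ 3 *\<^sub>R g0 x"
      using orthogonal_transformation_linear[OF T] by (simp add: g0_def u(2) prR linear_cmul)
    then show ?thesis ..
  qed
  define g where "g x = g0 x /\<^sub>R (g0 x \<bullet> x)" for x
  have g0x: "g0 x \<bullet> x \<noteq> 0" if x: "x \<in> Z" "N x = 1" for x
  proof -
    have "x \<noteq> 0" using x N by auto
    then obtain m where m: "supports N m x" using supporting_functional_exists[OF N] by blast
    obtain c where "m = c *\<^sub>R g0 x" using sup[OF x m] ..
    then show ?thesis using m x by (auto simp: supports_def)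
  qed
  have "m = g x" if x: "x \<in> Z" "N x = 1" and m: "supports N m x" for x m
  proof -
    obtain c where c: "m = c *\<^sub>R g0 x" using sup[OF x m] ..
    then have "c * (g0 x \<bullet> x) = 1" using m x by (simp add: supports_def)
    then have "c = inverse (g0 x \<bullet> x)" by (metis inverse_unique mult.commute)
    then show ?thesis by (simp add: g_def c)
  qed
  moreover have "g differentiable (at x)" if x: "x \<in> Z" "N x = 1" for x
  proof -
    have prx: "pr x \<in> U" using x by (simp add: Z_def)
    have 1: "((\<lambda>x. d i (pr x)) has_derivative
        frechet_derivative (d i) (at (pr x)) \<circ> pr) (at x)" for i
      unfolding d_def
      using diff_chain_at[OF bounded_linear.has_derivative[OF pr_lin has_derivative_ident]
        smooth_on_has_derivative[OF smooth_on_frechet_derivative[OF h, of "axis i 1"] prx]]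
      by (simp add: o_def)
    have "g0 differentiable (at x)"
      unfolding g0_def vector_3_eq_axis differentiable_def
      by (rule exI, rule bounded_linear.has_derivative[OF bl(1)]) (auto intro!: derivative_eq_intros 1)
    then show ?thesis unfolding g_def using g0x[OF x]
      by (auto intro!: differentiable_scaleR differentiable_inverse differentiable_inner)
  qed
  ultimately show ?thesis using that Z qZ by blast
qed

text \<open>Subgradients squeeze the increment of a convex function:
  \<open>n x \<bullet> (y - x) \<le> N y - N x \<le> n y \<bullet> (y - x)\<close>. So a continuous choice of subgradients
  is a derivative.\<close>

lemma norm_has_derivative_supporting:
  assumes sup: "\<And>y. y \<noteq> 0 \<Longrightarrow> supports N (n y) y" and x: "x \<noteq> 0" and cont: "isCont n x"
  shows "(N has_derivative (\<lambda>v. n x \<bullet> v)) (at x)"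
  unfolding has_derivative_at_within
proof (intro conjI bounded_linear_inner_right)
  have c: "(n \<longlongrightarrow> n x) (at x)"
    using cont isCont_def by blast
  have lim: "((\<lambda>y. norm (n y - n x)) \<longlongrightarrow> 0) (at x)"
    using tendsto_norm[OF tendsto_diff[OF c tendsto_const[of "n x"]]] by simp
  show "((\<lambda>y. (N y - N x - n x \<bullet> (y - x)) /\<^sub>R norm (y - x)) \<longlongrightarrow> 0) (at x)"
  proof (rule Lim_null_comparison[OF _ lim])
    have "\<forall>\<^sub>F y in at x. y \<noteq> 0 \<and> y \<noteq> x"
      using x eventually_neq_at_within[of 0 x UNIV] eventually_neq_at_within[of x x UNIV]
      by (simp add: eventually_conj_iff)
    then show "\<forall>\<^sub>F y in at x. norm ((N y - N x - n x \<bullet> (y - x)) /\<^sub>R norm (y - x)) \<le> norm (n y - n x)"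
    proof eventually_elim
      case (elim y)
      have "0 \<le> N y - N x - n x \<bullet> (y - x)"
        using sup[OF x] by (simp add: supports_def inner_diff_right)
      moreover have "N y - N x - n x \<bullet> (y - x) \<le> (n y - n x) \<bullet> (y - x)"
        using sup[of y] elim by (simp add: supports_def inner_diff_right inner_diff_left)
      moreover have "(n y - n x) \<bullet> (y - x) \<le> norm (n y - n x) * norm (y - x)"
        by (rule norm_cauchy_schwarz)
      ultimately show ?case using elim by (simp add: divide_simps mult.commute)
    qed
  qed
qed

text \<open>\<open>n\<close> is the gradient of \<open>N\<close>, and \<open>n' x\<close> the Hessian of \<open>N\<close> at \<open>x\<close> as a linear map.\<close>

locale smooth_norm =
  fixes N :: "real^3 \<Rightarrow> real" and n :: "real^3 \<Rightarrow> real^3" and n' :: "real^3 \<Rightarrow> real^3 \<Rightarrow> real^3"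
  assumes is_norm: "is_norm N"
    and n_supports: "x \<noteq> 0 \<Longrightarrow> supports N (n x) x"
    and n_derivative: "x \<noteq> 0 \<Longrightarrow> (n has_derivative n' x) (at x)"
begin

lemma n_self: "x \<noteq> 0 \<Longrightarrow> n x \<bullet> x = N x"
  using n_supports by (simp add: supports_def)

lemma n_le: "x \<noteq> 0 \<Longrightarrow> n x \<bullet> y \<le> N y"
  using n_supports by (simp add: supports_def)

lemma N_derivative: "x \<noteq> 0 \<Longrightarrow> (N has_derivative (\<lambda>v. n x \<bullet> v)) (at x)"
  using norm_has_derivative_supporting[of N n x] n_supports n_derivative has_derivative_continuous
  by blast

lemma supports_unique:
  assumes "x \<noteq> 0" "supports N m x"
  shows "m = n x"
proof -
  have "((\<lambda>y. N y - m \<bullet> y) has_derivative (\<lambda>v. n x \<bullet> v - m \<bullet> v)) (at x)"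
    by (auto intro!: derivative_eq_intros N_derivative[OF assms(1)])
  then have "(\<lambda>v. n x \<bullet> v - m \<bullet> v) = (\<lambda>v. 0)"
    using assms(2) by (intro differential_zero_maxmin[of x UNIV]) (auto simp: supports_def)
  then have "\<forall>v. m \<bullet> v = n x \<bullet> v" by (metis eq_iff_diff_eq_0)
  then show ?thesis using vector_eq_rdot by blast
qed

lemma n'_linear: "x \<noteq> 0 \<Longrightarrow> linear (n' x)"
  using n_derivative has_derivative_linear by blast

text \<open>Differentiate \<open>n x \<bullet> x = N x\<close>.\<close>

lemma n'_self: "x \<noteq> 0 \<Longrightarrow> n' x v \<bullet> x = 0"
proof -
  assume x: "x \<noteq> 0"
  have 1: "((\<lambda>y. n y \<bullet> y) has_derivative (\<lambda>v. n x \<bullet> v + n' x v \<bullet> x)) (at x)"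
    by (rule has_derivative_inner[OF n_derivative[OF x] has_derivative_ident])
  have 2: "((\<lambda>y. n y \<bullet> y) has_derivative (\<lambda>v. n x \<bullet> v)) (at x)"
    by (rule has_derivative_transform_within_open[OF N_derivative[OF x], of "-{0}"])
      (use x n_self in auto)
  show ?thesis using has_derivative_unique[OF 1 2] by (metis add_cancel_right_right)
qed

lemma n_monotone:
  assumes "x \<noteq> 0" "y \<noteq> 0"
  shows "0 \<le> (n y - n x) \<bullet> (y - x)"
  using n_self[OF assms(1)] n_self[OF assms(2)] n_le[OF assms(1), of y] n_le[OF assms(2), of x]
  by (simp add: inner_diff_left inner_diff_right)

lemma n'_nonneg:
  assumes x: "x \<noteq> 0"
  shows "n' x v \<bullet> v \<ge> 0"
proof -
  have "((\<lambda>t. n (x + t *\<^sub>R v) \<bullet> v) has_vector_derivative n' x v \<bullet> v) (at 0)"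
    by (rule has_derivative_along_line[where D = "\<lambda>w. n' x w \<bullet> v"])
      (use has_derivative_inner_left[OF n_derivative[OF x]] in simp)
  then have lim: "((\<lambda>t. (n (x + t *\<^sub>R v) \<bullet> v - n x \<bullet> v) / t) \<longlongrightarrow> n' x v \<bullet> v) (at 0)"
    by (simp add: has_real_derivative_iff_has_vector_derivative[symmetric] DERIV_def)
  show ?thesis
  proof (rule tendsto_lowerbound[OF lim])
    have "((\<lambda>t. x + t *\<^sub>R v) \<longlongrightarrow> x + 0 *\<^sub>R v) (at 0)" by (intro tendsto_intros)
    then have "\<forall>\<^sub>F t in at 0. x + t *\<^sub>R v \<in> - {0}"
      by (rule topological_tendstoD) (use x in auto)
    then show "\<forall>\<^sub>F t in at 0. 0 \<le> (n (x + t *\<^sub>R v) \<bullet> v - n x \<bullet> v) / t"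
    proof eventually_elim
      case (elim t)
      let ?y = "x + t *\<^sub>R v"
      have "0 \<le> (n ?y - n x) \<bullet> (?y - x)" using elim x by (intro n_monotone) auto
      then have "0 \<le> t * ((n ?y - n x) \<bullet> v)" by simp
      then show ?case by (auto simp: inner_diff_left zero_le_divide_iff zero_le_mult_iff)
    qed
  qed simp
qed

end

text \<open>The normal of the graph depends differentiably on \<open>x /\<^sub>R N x\<close>, but \<open>N\<close> is only known to be
  continuous at first. This makes \<open>n\<close> continuous, so that \<open>N\<close> has the derivative \<open>n\<close>; then
  \<open>x /\<^sub>R N x\<close> is differentiable, and so is \<open>n\<close>.\<close>

lemma smooth_norm_exists:
  assumes N: "is_norm N" and G: "locally_smooth_graph (unit_sphere N)"
  obtains n n' where "smooth_norm N n n'"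
proof -
  define n where "n x = (SOME m. supports N m x)" for x
  have sup: "supports N (n x) x" if "x \<noteq> 0" for x
    unfolding n_def using supporting_functional_exists[OF N that] by (rule someI_ex)
  have "n differentiable (at x)" if x: "x \<noteq> 0" for x
  proof -
    have Nx: "N x > 0" using N x by (rule is_norm_pos)
    obtain Z g where Z: "open Z" "x /\<^sub>R N x \<in> Z"
      and g: "\<And>y. y \<in> Z \<Longrightarrow> N y = 1 \<Longrightarrow> g differentiable (at y)"
      and gu: "\<And>y m. y \<in> Z \<Longrightarrow> N y = 1 \<Longrightarrow> supports N m y \<Longrightarrow> m = g y"
      by (rule graph_supporting_functional[OF N G is_norm_normalize[OF N x]], rule that)
    have near: "\<exists>V. open V \<and> x \<in> V \<and> (\<forall>y\<in>V. y \<noteq> 0 \<and> y /\<^sub>R N y \<in> Z)"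
    proof -
      have "continuous_on (-{0}) (\<lambda>y. y /\<^sub>R N y)"
        using is_norm_pos[OF N] by (intro continuous_intros is_norm_continuous[OF N]) fastforce
      then have "open ((\<lambda>y. y /\<^sub>R N y) -` Z \<inter> - {0})"
        using Z(1) continuous_on_open_vimage[of "- {0::real^3}"] by blast
      then show ?thesis using Z(2) x
        by (intro exI[of _ "(\<lambda>y. y /\<^sub>R N y) -` Z \<inter> - {0}"]) auto
    qed
    then obtain V where V: "open V" "x \<in> V" "\<And>y. y \<in> V \<Longrightarrow> y \<noteq> 0" "\<And>y. y \<in> V \<Longrightarrow> y /\<^sub>R N y \<in> Z"
      by blast
    have n_eq: "n y = g (y /\<^sub>R N y)" if y: "y \<in> V" for y
    proof (rule gu[OF V(4)[OF y] is_norm_normalize[OF N V(3)[OF y]]])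
      show "supports N (n y) (y /\<^sub>R N y)"
        using sup[OF V(3)[OF y]] is_norm_pos[OF N V(3)[OF y]] supports_scaleR[OF N] by simp
    qed
    have gx: "g differentiable (at (x /\<^sub>R N x))"
      using g[OF V(4)[OF V(2)] is_norm_normalize[OF N x]] .
    have cN: "isCont (\<lambda>y. y /\<^sub>R N y) x"
      using is_norm_continuous[OF N, of UNIV] Nx
      by (intro continuous_intros) (auto simp: continuous_on_eq_continuous_at)
    have "isCont (\<lambda>y. g (y /\<^sub>R N y)) x"
      using continuous_within_compose3[OF differentiable_imp_continuous_within[OF gx] cN] by simp
    then have "isCont n x"
      using continuous_transform_within_openin[of x UNIV "\<lambda>y. g (y /\<^sub>R N y)" V n] V(1,2) n_eq by simp
    then have "(N has_derivative (\<lambda>v. n x \<bullet> v)) (at x)"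
      using norm_has_derivative_supporting[of N n x] sup x by blast
    then have "N differentiable (at x)" unfolding differentiable_def by blast
    then have "(\<lambda>y. y /\<^sub>R N y) differentiable (at x)"
      using Nx by (intro differentiable_scaleR differentiable_inverse differentiable_ident) auto
    then have "(g \<circ> (\<lambda>y. y /\<^sub>R N y)) differentiable (at x)"
      using gx by (intro differentiable_chain_at)
    then show ?thesis
      using V(1,2) n_eq unfolding differentiable_def o_def
      by (metis (no_types, lifting) has_derivative_transform_within_open)
  qed
  then have "\<forall>x. \<exists>D. x \<noteq> 0 \<longrightarrow> (n has_derivative D) (at x)" unfolding differentiable_def by blast
  then obtain n' where "\<And>x. x \<noteq> 0 \<Longrightarrow> (n has_derivative n' x) (at x)" by metis
  then show ?thesis using that N sup unfolding smooth_norm_def by blast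
qed

lemma range_eq_hyperplane:
  fixes D :: "real^2 \<Rightarrow> real^3"
  assumes D: "linear D" "inj D" and m: "m \<noteq> 0" "\<And>v. m \<bullet> D v = 0"
  shows "range D = {z. m \<bullet> z = 0}"
proof (rule subspace_dim_equal)
  show "subspace (range D)" using D(1) by (simp add: linear_subspace_image)
  show "subspace {z. m \<bullet> z = 0}" by (rule subspace_hyperplane)
  show "range D \<subseteq> {z. m \<bullet> z = 0}" using m(2) by auto
  have "dim (range D) = 2" using dim_image_eq[OF D(1), of UNIV] D(2) by simp
  then show "dim {z. m \<bullet> z = 0} \<le> dim (range D)" using dim_hyperplane[OF m(1)] by simp
qed

lemma orthogonal_to_hyperplane:
  fixes c m :: "'a::real_inner"
  assumes m: "m \<noteq> 0" and c: "\<And>z. m \<bullet> z = 0 \<Longrightarrow> c \<bullet> z = 0"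
  shows "\<exists>k. c = k *\<^sub>R m"
proof -
  let ?d = "c - ((c \<bullet> m) / (m \<bullet> m)) *\<^sub>R m"
  have 1: "m \<bullet> ?d = 0" using m by (simp add: inner_diff_right inner_commute)
  have "?d \<bullet> ?d = c \<bullet> ?d - ((c \<bullet> m) / (m \<bullet> m)) * (m \<bullet> ?d)"
    by (simp only: inner_diff_left inner_scaleR_left)
  also have "\<dots> = 0" using c[OF 1] 1 by simp
  finally show ?thesis by (metis inner_eq_zero_iff right_minus_eq)
qed

lemma real_2_axis_expansion: "(w :: real^2) = w$1 *\<^sub>R axis 1 1 + w$2 *\<^sub>R axis 2 1"
  by (simp add: vec_eq_iff forall_2 axis_def)

context smooth_norm begin

text \<open>The second fundamental form of the unit sphere, up to a factor, is \<open>n' q X \<bullet> Y\<close>: differentiate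
  \<open>n (r v) \<bullet> \<partial>\<^sub>w r (v) = 0\<close> for a parametrization \<open>r\<close>. Its symmetry is the symmetry of second
  derivatives; being nonnegative by monotonicity of \<open>n\<close>, it is definite as soon as its determinant
  is positive.\<close>

lemma n'_symmetric_definite:
  assumes K: "has_gauss_curvature (unit_sphere N) q K" "K > 0"
  shows "\<And>X Y. n q \<bullet> X = 0 \<Longrightarrow> n q \<bullet> Y = 0 \<Longrightarrow> n' q X \<bullet> Y = n' q Y \<bullet> X"
    and "\<And>X. n q \<bullet> X = 0 \<Longrightarrow> X \<noteq> 0 \<Longrightarrow> n' q X \<bullet> X > 0"
proof -
  obtain r U u where U: "open U" "u \<in> U" and r: "smooth_on U r"
    and inj: "\<And>v. v \<in> U \<Longrightarrow> inj (frechet_derivative r (at v))"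
    and sub: "r ` U \<subseteq> unit_sphere N" and ru: "r u = q" and Kdef: "K = param_gauss_curvature r u"
    using K(1) unfolding has_gauss_curvature_def by blast
  define r' where "r' v = frechet_derivative r (at v)" for v
  have rD: "(r has_derivative r' v) (at v)" if "v \<in> U" for v
    unfolding r'_def using smooth_on_has_derivative[OF r that] .
  define r'' where "r'' w = frechet_derivative (\<lambda>v. r' v w) (at u)" for w
  have rD2: "((\<lambda>v. r' v w) has_derivative r'' w) (at u)" for w
    unfolding r''_def r'_def
    using smooth_on_has_derivative[OF smooth_on_frechet_derivative[OF r] U(2)] .
  have sym: "r'' v w = r'' w v" for v w
    unfolding r''_def r'_def using second_derivative_symmetric[OF r U] .
  have Nr: "N (r v) = 1" if "v \<in> U" for v using sub that unfolding unit_sphere_def by blast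
  have r0: "r v \<noteq> 0" if "v \<in> U" for v using Nr[OF that] is_norm by auto
  have q0: "q \<noteq> 0" using r0 U(2) ru by blast
  have nr: "n (r v) \<bullet> r' v w = 0" if v: "v \<in> U" for v w
  proof -
    have "((\<lambda>v. N (r v)) has_derivative (\<lambda>w. n (r v) \<bullet> r' v w)) (at v)"
      using diff_chain_at[OF rD[OF v] N_derivative[OF r0[OF v]]] by (simp add: o_def)
    moreover have "((\<lambda>v. N (r v)) has_derivative (\<lambda>w. 0)) (at v)"
      by (rule has_derivative_transform_within_open[OF has_derivative_const[of 1] U(1) v])
        (simp add: Nr)
    ultimately have "(\<lambda>w. n (r v) \<bullet> r' v w) = (\<lambda>w. 0)" by (rule has_derivative_unique)
    then show ?thesis by (rule fun_cong)
  qed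
  have nq0: "n q \<noteq> 0" using n_self[OF q0] Nr[OF U(2)] ru by auto
  have lin: "linear (r' u)" using rD[OF U(2)] has_derivative_linear by blast
  have rng: "range (r' u) = {z. n q \<bullet> z = 0}"
    using range_eq_hyperplane[OF lin _ nq0] inj[OF U(2)] nr[OF U(2)] by (simp add: r'_def ru)
  define B where "B w z = n' q (r' u w) \<bullet> r' u z" for w z
  have Bn: "B w z = - (n q \<bullet> r'' z w)" for w z
  proof -
    have "((\<lambda>v. n (r v)) has_derivative (\<lambda>w. n' q (r' u w))) (at u)"
      using diff_chain_at[OF rD[OF U(2)] n_derivative[OF r0[OF U(2)]]] by (simp add: o_def ru)
    from has_derivative_inner[OF this rD2[of z]]
    have "((\<lambda>v. n (r v) \<bullet> r' v z) has_derivative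
        (\<lambda>w. n q \<bullet> r'' z w + n' q (r' u w) \<bullet> r' u z)) (at u)" by (simp add: ru)
    moreover have "((\<lambda>v. n (r v) \<bullet> r' v z) has_derivative (\<lambda>w. 0)) (at u)"
      by (rule has_derivative_transform_within_open[OF has_derivative_const[of 0] U]) (simp add: nr)
    ultimately have "(\<lambda>w. n q \<bullet> r'' z w + n' q (r' u w) \<bullet> r' u z) = (\<lambda>w. 0)"
      by (rule has_derivative_unique)
    from fun_cong[OF this, of w] show ?thesis by (simp add: B_def)
  qed
  have Bsym: "B w z = B z w" for w z by (simp add: Bn sym)
  show "n' q X \<bullet> Y = n' q Y \<bullet> X" if "n q \<bullet> X = 0" "n q \<bullet> Y = 0" for X Y
  proof -
    have "X \<in> range (r' u)" "Y \<in> range (r' u)" using that unfolding rng by auto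
    then obtain w z where "X = r' u w" "Y = r' u z" by blast
    then show ?thesis using Bsym unfolding B_def by simp
  qed
  define a1 :: "real^2" where "a1 = axis 1 1"
  define a2 :: "real^2" where "a2 = axis 2 1"
  define \<nu> where "\<nu> = sgn (cross3 (r' u a1) (r' u a2))"
  have expand: "r' u w = w$1 *\<^sub>R r' u a1 + w$2 *\<^sub>R r' u a2" for w
    by (subst real_2_axis_expansion) (simp add: linear_add[OF lin] linear_cmul[OF lin] a1_def a2_def)
  have *: "cross3 (r' u a1) (r' u a2) \<bullet> r' u w = 0" for w
    unfolding expand[of w] by (simp add: inner_add_right dot_cross_self)
  have "\<nu> \<bullet> z = 0" if "n q \<bullet> z = 0" for z
  proof -
    have "z \<in> range (r' u)" using that unfolding rng by simp
    then show ?thesis using * unfolding \<nu>_def sgn_div_norm by auto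
  qed
  then obtain k where k: "\<nu> = k *\<^sub>R n q" using orthogonal_to_hyperplane[OF nq0] by blast
  have II: "r'' w z \<bullet> \<nu> = - k * B w z" for w z
    unfolding k using Bn[of z w] by (simp add: Bsym inner_commute)
  define d where "d = B a1 a1 * B a2 a2 - (B a1 a2)\<^sup>2"
  define dI where "dI = (r' u a1 \<bullet> r' u a1) * (r' u a2 \<bullet> r' u a2) - (r' u a1 \<bullet> r' u a2)\<^sup>2"
  have pd: "pd r 1 = (\<lambda>v. r' v a1)" "pd r 2 = (\<lambda>v. r' v a2)"
    by (auto simp: pd_def r'_def a1_def a2_def)
  have "K = ((r'' a1 a1 \<bullet> \<nu>) * (r'' a2 a2 \<bullet> \<nu>) - (r'' a1 a2 \<bullet> \<nu>)\<^sup>2) / dI"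
    unfolding Kdef param_gauss_curvature_def Let_def pd
    by (simp add: pd_def \<nu>_def dI_def r''_def a1_def a2_def)
  also have "\<dots> = k\<^sup>2 * d / dI"
    unfolding II by (simp add: d_def algebra_simps power2_eq_square)
  finally have "k\<^sup>2 * d / dI > 0" using K(2) by simp
  moreover have "dI \<ge> 0" using Cauchy_Schwarz_ineq[of "r' u a1" "r' u a2"] by (simp add: dI_def)
  ultimately have d: "d > 0" by (simp add: zero_less_divide_iff zero_less_mult_iff)
  have Bpos: "B w w \<ge> 0" for w unfolding B_def using n'_nonneg[OF q0] .
  have B1: "B a1 a1 > 0"
  proof (rule ccontr)
    assume "\<not> B a1 a1 > 0"
    then have "B a1 a1 = 0" using Bpos[of a1] by simp
    then show False using d by (simp add: d_def)
  qed
  show "n' q X \<bullet> X > 0" if X: "n q \<bullet> X = 0" "X \<noteq> 0" for X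
  proof -
    have "X \<in> range (r' u)" using X unfolding rng by auto
    then obtain w where w: "X = r' u w" by blast
    then have "w \<noteq> 0" using X(2) linear_0[OF lin] by auto
    then have w12: "w$1 \<noteq> 0 \<or> w$2 \<noteq> 0" by (auto simp: vec_eq_iff forall_2)
    have "B w w = (w$1)\<^sup>2 * B a1 a1 + 2 * (w$1 * w$2 * B a1 a2) + (w$2)\<^sup>2 * B a2 a2"
      using Bsym[of a1 a2] unfolding B_def expand[of w]
      by (simp add: linear_add[OF n'_linear[OF q0]] linear_cmul[OF n'_linear[OF q0]]
          inner_add_left inner_add_right power2_eq_square algebra_simps)
    then have "B a1 a1 * B w w = (w$1 * B a1 a1 + w$2 * B a1 a2)\<^sup>2 + (w$2)\<^sup>2 * d"
      by (simp add: d_def power2_eq_square algebra_simps)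
    also have "\<dots> > 0"
    proof (cases "w$2 = 0")
      case True
      then show ?thesis using w12 B1 by simp
    next
      case False
      then have "(w$2)\<^sup>2 * d > 0" using d by simp
      then show ?thesis by (smt (verit) zero_le_power2)
    qed
    finally show ?thesis using B1 unfolding B_def w by (simp add: zero_less_mult_iff)
  qed
qed

end

section \<open>Rayleigh quotients of a pair of symmetric forms\<close>

text \<open>The form \<open>q\<close> plays the role of an inner product and \<open>p\<close> that of a self-adjoint operator. An
  eigenvector for \<open>k1\<close> and a \<open>q\<close>-orthogonal vector diagonalize both forms, and the second one belongs
  to \<open>k2\<close>, because \<open>k1\<close> and \<open>k2\<close> are all the eigenvalues.\<close>

lemma Rayleigh_quotient_bounds:
  fixes p q :: "real^2 \<Rightarrow> real^2 \<Rightarrow> real"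
  assumes p: "bilinear p" "\<And>v w. p v w = p w v" and q: "bilinear q" "\<And>v w. q v w = q w v"
    and pos: "\<And>v. v \<noteq> 0 \<Longrightarrow> q v v > 0"
    and eigen: "{l. \<exists>w. w \<noteq> 0 \<and> (\<forall>v. p w v = l * q w v)} = {k1, k2}" and le: "k2 \<le> k1"
    and w: "w \<noteq> 0"
  shows "k2 * q w w \<le> p w w" "p w w \<le> k1 * q w w"
    and "p w w = k1 * q w w \<Longrightarrow> p w v = k1 * q w v"
    and "p w w = k2 * q w w \<Longrightarrow> p w v = k2 * q w v"
proof -
  note bil = bilinear_ladd[OF p(1)] bilinear_radd[OF p(1)] bilinear_lmul[OF p(1)] bilinear_rmul[OF p(1)]
    bilinear_ladd[OF q(1)] bilinear_radd[OF q(1)] bilinear_lmul[OF q(1)] bilinear_rmul[OF q(1)]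
  obtain e1 where e1: "e1 \<noteq> 0" "\<And>v. p e1 v = k1 * q e1 v" using eigen by blast
  define Y :: "real^2" where "Y = vector [- e1$2, e1$1]"
  define c where "c = q Y e1 / q e1 e1"
  define e2 where "e2 = Y + (- c) *\<^sub>R e1"
  have q11: "q e1 e1 > 0" using pos e1(1) .
  have sq: "(e1$1)\<^sup>2 + (e1$2)\<^sup>2 \<noteq> 0" using e1(1) by (auto simp: vec_eq_iff forall_2 sum_power2_eq_zero_iff)
  have "e2 \<noteq> 0"
  proof
    assume "e2 = 0"
    then have "Y = c *\<^sub>R e1" by (simp add: e2_def)
    then have 1: "- e1$2 = c * e1$1" and 2: "e1$1 = c * e1$2"
      by (simp_all add: Y_def vec_eq_iff forall_2)
    have "(e1$1)\<^sup>2 + (e1$2)\<^sup>2 = e1$1 * (c * e1$2) - (c * e1$1) * e1$2"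
      unfolding 1[symmetric] 2[symmetric] by (simp add: power2_eq_square)
    then show False using sq by simp
  qed
  then have q22: "q e2 e2 > 0" using pos by blast
  have "q e2 e1 = q Y e1 + (- c) * q e1 e1" unfolding e2_def by (simp only: bil real_scaleR_def)
  then have q21: "q e2 e1 = 0" using q11 by (simp add: c_def)
  then have q12: "q e1 e2 = 0" using q(2) by metis
  have p12: "p e1 e2 = 0" using e1(2) q12 by simp
  then have p21: "p e2 e1 = 0" using p(2) by metis
  have span: "\<exists>a b. v = a *\<^sub>R e1 + b *\<^sub>R e2" for v
  proof -
    define D where "D = (e1$1)\<^sup>2 + (e1$2)\<^sup>2"
    define b where "b = (- e1$2 * v$1 + e1$1 * v$2) / D"
    define a where "a = (e1$1 * v$1 + e1$2 * v$2) / D"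
    have D: "D \<noteq> 0" using sq by (simp add: D_def)
    have "v = a *\<^sub>R e1 + b *\<^sub>R Y"
      using D by (simp add: vec_eq_iff forall_2 Y_def a_def b_def field_simps)
        (simp add: D_def power2_eq_square algebra_simps)
    then have "v = (a + b * c) *\<^sub>R e1 + b *\<^sub>R e2" by (simp add: e2_def algebra_simps)
    then show ?thesis by blast
  qed
  define \<mu> where "\<mu> = p e2 e2 / q e2 e2"
  have p22: "p e2 e2 = \<mu> * q e2 e2" using q22 by (simp add: \<mu>_def)
  have "\<forall>v. p e2 v = \<mu> * q e2 v"
  proof
    fix v
    obtain a b where v: "v = a *\<^sub>R e1 + b *\<^sub>R e2" using span by blast
    show "p e2 v = \<mu> * q e2 v" unfolding v by (simp add: bil q21 p21 p22)
  qed
  then have \<mu>: "\<mu> \<in> {k1, k2}" using \<open>e2 \<noteq> 0\<close> eigen by blast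
  have \<mu>k: "\<mu> = k2"
  proof (rule ccontr)
    assume ne: "\<mu> \<noteq> k2"
    then have k12: "k1 \<noteq> k2" using \<mu> by auto
    obtain u where u: "u \<noteq> 0" "\<And>v. p u v = k2 * q u v" using eigen by blast
    obtain a b where ab: "u = a *\<^sub>R e1 + b *\<^sub>R e2" using span by blast
    have "a * k1 * q e1 e1 = k2 * a * q e1 e1"
      using u(2)[of e1] unfolding ab by (auto simp: bil q21 p21 e1(2))
    then have "a = 0" using q11 k12 by auto
    moreover have "b * \<mu> * q e2 e2 = k2 * b * q e2 e2"
      using u(2)[of e2] unfolding ab by (auto simp: bil q12 p12 p22)
    then have "b = 0" using q22 ne by auto
    ultimately show False using u(1) ab by simp
  qed
  obtain a b where ab: "w = a *\<^sub>R e1 + b *\<^sub>R e2" using span by blast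
  have pw: "p w w = k1 * (a * a * q e1 e1) + k2 * (b * b * q e2 e2)"
    unfolding ab by (simp add: bil q12 p12 p21 q21 p22 e1(2) \<mu>k algebra_simps)
  have qw: "q w w = a * a * q e1 e1 + b * b * q e2 e2"
    unfolding ab by (simp add: bil q12 q21 algebra_simps)
  have A: "a * a * q e1 e1 \<ge> 0" and B: "b * b * q e2 e2 \<ge> 0" using q11 q22 by simp_all
  show "k2 * q w w \<le> p w w"
    unfolding pw qw using mult_right_mono[OF le A] by (simp add: algebra_simps)
  show "p w w \<le> k1 * q w w"
    unfolding pw qw using mult_right_mono[OF le B] by (simp add: algebra_simps)
  obtain x y where v: "v = x *\<^sub>R e1 + y *\<^sub>R e2" using span by blast
  have pv: "p w v = k1 * (a * x * q e1 e1) + k2 * (b * y * q e2 e2)"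
    unfolding ab v by (simp add: bil q12 p12 p21 q21 p22 e1(2) \<mu>k algebra_simps)
  have qv: "q w v = a * x * q e1 e1 + b * y * q e2 e2"
    unfolding ab v by (simp add: bil q12 q21 algebra_simps)
  show "p w v = k1 * q w v" if "p w w = k1 * q w w"
  proof -
    have "(k1 - k2) * (b * b * q e2 e2) = 0" using that unfolding pw qw by argo
    then have "k1 = k2 \<or> b = 0" using q22 by auto
    then show ?thesis unfolding pv qv by (auto simp: algebra_simps)
  qed
  show "p w v = k2 * q w v" if "p w w = k2 * q w w"
  proof -
    have "(k1 - k2) * (a * a * q e1 e1) = 0" using that unfolding pw qw by argo
    then have "k1 = k2 \<or> a = 0" using q11 by auto
    then show ?thesis unfolding pv qv by (auto simp: algebra_simps)
  qed
qed

section \<open>Arc length parametrizations\<close>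

text \<open>\<open>\<theta>\<close> is the inverse of an antiderivative \<open>L\<close> of the speed \<open>v\<close>; the lower bound on the speed makes
  \<open>L\<close> surjective. Reparametrizing a curve of speed \<open>v\<close> by \<open>\<theta>\<close> gives unit speed.\<close>

lemma inverse_speed_reparametrization:
  fixes v :: "real \<Rightarrow> real"
  assumes cont: "continuous_on UNIV v" and c: "c > 0" "\<And>x. c \<le> v x"
  obtains \<theta> L where "\<theta> 0 = 0" "\<And>t. (\<theta> has_real_derivative 1 / v (\<theta> t)) (at t)"
    "\<And>x. isCont L x" "\<And>t. L (\<theta> t) = t" "\<And>x. \<theta> (L x) = x"
proof -
  define L where "L x = (LBINT y=0..x. v y)" for x :: real
  have DL: "(L has_real_derivative v x) (at x)" for x
  proof -
    define b where "b = \<bar>x\<bar> + 1"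
    have b: "- b < 0" "0 < b" "- b < x" "x < b" unfolding b_def by linarith+
    have "(L has_vector_derivative v x) (at x within {- b..b})"
      unfolding L_def using interval_integral_FTC2[of "- b" 0 b v x] b continuous_on_subset[OF cont]
      by (simp add: zero_ereal_def)
    moreover have "at x within {- b..b} = at x"
      using b by (intro at_within_interior) auto
    ultimately show ?thesis by (simp add: has_real_derivative_iff_has_vector_derivative)
  qed
  have L0: "L 0 = 0" by (simp add: L_def zero_ereal_def)
  have grow: "c * (y - x) \<le> L y - L x" if xy: "x \<le> y" for x y
  proof (cases "x = y")
    case False
    then obtain z where "L y - L x = (y - x) * v z" using MVT2[of x y L v] DL xy by force
    then show ?thesis using c(2)[of z] xy by (simp add: mult.commute mult_right_mono)
  qed simp
  have inj: "inj L"
  proof (rule linorder_injI)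
    fix x y :: real assume "x < y"
    then have "c * (y - x) > 0" using c(1) by simp
    then show "L x \<noteq> L y" using grow[of x y] \<open>x < y\<close> by simp
  qed
  have isc: "isCont L x" for x using DL DERIV_isCont by blast
  have "\<exists>x. L x = y" for y
  proof -
    define b where "b = \<bar>y\<bar> / c"
    have b: "b \<ge> 0" "c * b = \<bar>y\<bar>" using c(1) by (simp_all add: b_def)
    have "L (- b) \<le> y" "y \<le> L b" using grow[of "- b" 0] grow[of 0 b] b L0 by auto
    then show ?thesis using IVT[of L "- b" y b] isc b(1) by auto
  qed
  then have surj: "surj L" by (metis surjI)
  define \<theta> where "\<theta> = inv L"
  have L\<theta>: "L (\<theta> y) = y" and \<theta>L: "\<theta> (L x) = x" for x y
    using surj inj by (simp_all add: \<theta>_def surj_f_inv_f inv_f_f)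
  have c\<theta>: "isCont \<theta> y" for y
    using isCont_inverse_function[of 1 "\<theta> y" \<theta> L] isc \<theta>L L\<theta> by simp
  have "(\<theta> has_real_derivative inverse (v (\<theta> y))) (at y)" for y
  proof (rule DERIV_inverse_function)
    show "v (\<theta> y) \<noteq> 0" using c(1) c(2)[of "\<theta> y"] by linarith
    show "y - 1 < y" "y < y + 1" by simp_all
  qed (use DL L\<theta> c\<theta> in auto)
  moreover have "\<theta> 0 = 0" using \<theta>L[of 0] L0 by simp
  ultimately show ?thesis using that[of \<theta> L] isc L\<theta> \<theta>L by (simp add: inverse_eq_divide)
qed

context smooth_norm begin

lemma N_pos: "x \<noteq> 0 \<Longrightarrow> N x > 0"
  using is_norm is_norm_pos by blast

lemma isCont_n: "x \<noteq> 0 \<Longrightarrow> isCont n x"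
  using n_derivative has_derivative_continuous by blast

lemma continuous_on_n_compose:
  assumes "continuous_on S g" "\<And>x. x \<in> S \<Longrightarrow> g x \<noteq> 0"
  shows "continuous_on S (\<lambda>x. n (g x))"
proof -
  have "continuous_on (- {0}) n" using isCont_n by (intro continuous_at_imp_continuous_on) auto
  then show ?thesis using assms(1) by (rule continuous_on_compose2) (use assms(2) in auto)
qed

lemma continuous_on_N_compose: "continuous_on S g \<Longrightarrow> continuous_on S (\<lambda>x. N (g x))"
  using continuous_on_compose2[OF is_norm_continuous[OF is_norm, of UNIV]] by blast

lemma N_compose_derivative:
  assumes "(g has_vector_derivative g') (at t)" "g t \<noteq> 0"
  shows "((\<lambda>t. N (g t)) has_real_derivative n (g t) \<bullet> g') (at t)"
  using vector_derivative_diff_chain_within[OF assms(1), of N "\<lambda>v. n (g t) \<bullet> v"]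
    N_derivative[OF assms(2)]
  by (simp add: o_def has_real_derivative_iff_has_vector_derivative has_derivative_at_withinI)

lemma n_compose_derivative:
  assumes "(g has_vector_derivative g') (at t)" "g t \<noteq> 0"
  shows "((\<lambda>t. n (g t)) has_vector_derivative n' (g t) g') (at t)"
  using vector_derivative_diff_chain_within[OF assms(1), of n "n' (g t)"]
    n_derivative[OF assms(2)]
  by (simp add: o_def has_derivative_at_withinI)

text \<open>In the plane spanned by \<open>a\<close> and \<open>b\<close>, project the Euclidean circle of the basis \<open>(a, b)\<close> radially
  to the unit sphere and reparametrize by arc length. The speed is bounded below because it is
  periodic.\<close>

lemma unit_circle_param_exists:
  assumes ab: "\<And>x y. x *\<^sub>R a + y *\<^sub>R b = 0 \<Longrightarrow> x = 0 \<and> y = 0" and Na: "N a = 1"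
  obtains \<phi> where "unit_circle_param N a b \<phi>" "\<phi> 0 = a"
proof -
  define e where "e x y = x *\<^sub>R a + y *\<^sub>R b" for x y :: real
  define d where "d x y = n (e x y) \<bullet> (y *\<^sub>R (- a) + x *\<^sub>R b)" for x y :: real
  define s where "s x y = (1 / N (e x y)) *\<^sub>R e x y" for x y
  define s' where "s' x y = (- y / N (e x y) - d x y * x / (N (e x y))\<^sup>2) *\<^sub>R a
      + (x / N (e x y) - d x y * y / (N (e x y))\<^sup>2) *\<^sub>R b" for x y
  have e0: "e x y \<noteq> 0" if "x\<^sup>2 + y\<^sup>2 = 1" for x y
    using ab[of x y] that unfolding e_def by auto
  have e0': "e (cos x) (sin x) \<noteq> 0" for x by (rule e0) simp
  have g0: "N (e (cos x) (sin x)) > 0" for x using N_pos[OF e0'] .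
  have s'0: "s' x y \<noteq> 0" if xy: "x\<^sup>2 + y\<^sup>2 = 1" for x y
  proof
    assume "s' x y = 0"
    let ?g = "N (e x y)"
    have g: "?g > 0" using N_pos[OF e0[OF xy]] .
    have "- y / ?g - d x y * x / ?g\<^sup>2 = 0" "x / ?g - d x y * y / ?g\<^sup>2 = 0"
      using ab \<open>s' x y = 0\<close> unfolding s'_def by blast+
    then have "x * (x / ?g - d x y * y / ?g\<^sup>2) - y * (- y / ?g - d x y * x / ?g\<^sup>2) = 0" by simp
    then have "(x\<^sup>2 + y\<^sup>2) / ?g = 0" by (simp add: algebra_simps power2_eq_square add_divide_distrib)
    then show False using xy g by simp
  qed
  have De: "((\<lambda>x. e (cos x) (sin x)) has_vector_derivative sin x *\<^sub>R (- a) + cos x *\<^sub>R b) (at x)" for x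
    unfolding e_def by (auto intro!: derivative_eq_intros)
  have Dg: "((\<lambda>x. N (e (cos x) (sin x))) has_real_derivative d (cos x) (sin x)) (at x)" for x
    unfolding d_def by (rule N_compose_derivative[OF De e0'])
  have Ds: "((\<lambda>x. s (cos x) (sin x)) has_vector_derivative s' (cos x) (sin x)) (at x)" for x
  proof -
    let ?g = "N (e (cos x) (sin x))"
    have "((\<lambda>x. 1 / N (e (cos x) (sin x))) has_real_derivative - (d (cos x) (sin x) / ?g\<^sup>2)) (at x)"
      using DERIV_divide[OF DERIV_const[of 1] Dg[of x]] g0[of x] by (simp add: power2_eq_square)
    from has_vector_derivative_scaleR[OF this De[of x]]
    show ?thesis unfolding s_def
      by (rule has_vector_derivative_eq_rhs)
        (simp add: s'_def e_def algebra_simps)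
  qed
  have ce: "continuous_on UNIV (\<lambda>x. e (cos x) (sin x))"
    unfolding e_def by (intro continuous_intros)
  have cs': "continuous_on UNIV (\<lambda>x. s' (cos x) (sin x))"
    unfolding s'_def d_def
    using g0 by (intro continuous_intros continuous_on_N_compose continuous_on_n_compose ce)
      (auto simp: e0' less_imp_neq[symmetric])
  define v where "v x = N (s' (cos x) (sin x))" for x
  have cv: "continuous_on UNIV v" unfolding v_def by (rule continuous_on_N_compose[OF cs'])
  have v0: "v x > 0" for x unfolding v_def by (rule N_pos[OF s'0]) simp
  obtain x0 where x0: "\<And>x. x \<in> {0..2*pi} \<Longrightarrow> v x0 \<le> v x"
    using continuous_attains_inf[of "{0..2*pi}" v] continuous_on_subset[OF cv, of "{0..2*pi}"] by fastforce
  have bound: "v x0 \<le> v x" for x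
  proof -
    obtain t where "0 \<le> t" "t < 2*pi" "cos x = cos t" "sin x = sin t"
      using sincos_total_2pi[of "cos x" "sin x"] by auto
    then show ?thesis using x0[of t] by (simp add: v_def)
  qed
  obtain \<theta> L where \<theta>: "\<theta> 0 = 0" "\<And>t. (\<theta> has_real_derivative 1 / v (\<theta> t)) (at t)"
    and "\<And>x. \<theta> (L x) = x"
    by (rule inverse_speed_reparametrization[OF cv v0 bound], rule that)
  then have surj: "surj \<theta>" by (metis surjI)
  define \<phi> where "\<phi> t = s (cos (\<theta> t)) (sin (\<theta> t))" for t
  define \<phi>' where "\<phi>' t = (1 / v (\<theta> t)) *\<^sub>R s' (cos (\<theta> t)) (sin (\<theta> t))" for t
  have D\<phi>: "(\<phi> has_vector_derivative \<phi>' t) (at t)" for t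
    using vector_diff_chain_at[OF \<theta>(2)[of t, unfolded has_real_derivative_iff_has_vector_derivative] Ds]
    by (simp add: o_def \<phi>_def[abs_def] \<phi>'_def)
  have vd: "vector_derivative \<phi> (at t) = \<phi>' t" for t using D\<phi> by (rule vector_derivative_at)
  have c\<theta>: "continuous_on UNIV \<theta>"
    using \<theta>(2) DERIV_isCont by (intro continuous_at_imp_continuous_on) blast
  have "continuous_on UNIV \<phi>'"
    unfolding \<phi>'_def
    using v0 continuous_on_compose2[OF cv c\<theta>] continuous_on_compose2[OF cs' c\<theta>]
    by (intro continuous_intros) (auto simp: less_imp_neq[symmetric])
  then have "\<phi> C1_differentiable_on UNIV"
    unfolding C1_differentiable_on_def using D\<phi> by blast
  moreover have "N (\<phi>' t) = 1" for t
    using v0[of "\<theta> t"] unfolding \<phi>'_def by (simp add: is_norm_scaleR[OF is_norm] v_def)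
  ultimately have arc: "arc_length_on N UNIV \<phi>" by (simp add: arc_length_on_def vd)
  have "range \<phi> = range (\<lambda>x. s (cos x) (sin x))"
    using image_comp[of "\<lambda>x. s (cos x) (sin x)" \<theta> UNIV] surj
    by (simp add: \<phi>_def[abs_def] o_def)
  also have "\<dots> = unit_sphere N \<inter> span {a, b}"
  proof (intro equalityI subsetI)
    fix z assume "z \<in> range (\<lambda>x. s (cos x) (sin x))"
    then obtain x where z: "z = s (cos x) (sin x)" by blast
    have "N z = 1" unfolding z s_def using g0[of x] by (simp add: is_norm_scaleR[OF is_norm])
    moreover have "z \<in> span {a, b}" unfolding z s_def e_def
      by (intro span_scale span_add) (auto intro: span_base)
    ultimately show "z \<in> unit_sphere N \<inter> span {a, b}" by (simp add: unit_sphere_def)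
  next
    fix z assume "z \<in> unit_sphere N \<inter> span {a, b}"
    then have Nz: "N z = 1" and "z \<in> span {a, b}" by (auto simp: unit_sphere_def)
    then obtain x y where z: "z = x *\<^sub>R a + y *\<^sub>R b" by (auto simp: span_insert algebra_simps span_singleton)
    define r where "r = sqrt (x\<^sup>2 + y\<^sup>2)"
    have "\<not> (x = 0 \<and> y = 0)" using Nz z is_norm by auto
    then have "x\<^sup>2 + y\<^sup>2 > 0" using sum_power2_gt_zero_iff[of x y] by blast
    then have r: "r > 0" unfolding r_def by (rule real_sqrt_gt_zero)
    have "(x / r)\<^sup>2 + (y / r)\<^sup>2 = 1"
      using \<open>\<not> (x = 0 \<and> y = 0)\<close> by (simp add: power_divide add_divide_distrib[symmetric] r_def)
    then obtain t where t: "x / r = cos t" "y / r = sin t" using sincos_total_2pi by metis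
    have "e (cos t) (sin t) = (1 / r) *\<^sub>R z"
      unfolding e_def t[symmetric] z by (simp add: algebra_simps)
    then have "s (cos t) (sin t) = z"
      unfolding s_def using r Nz by (simp add: is_norm_scaleR[OF is_norm])
    then show "z \<in> range (\<lambda>x. s (cos x) (sin x))" by blast
  qed
  finally have rng: "range \<phi> = unit_sphere N \<inter> span {a, b}" .
  have "pos_oriented a b (\<phi> t) (\<phi>' t)" for t
  proof -
    define x where "x = cos (\<theta> t)"
    define y where "y = sin (\<theta> t)"
    define g where "g = N (e x y)"
    define k where "k = 1 / v (\<theta> t)"
    have xy: "x\<^sup>2 + y\<^sup>2 = 1" by (simp add: x_def y_def)
    have g: "g > 0" unfolding g_def using N_pos[OF e0[OF xy]] .
    have k: "k > 0" using v0 by (simp add: k_def)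
    have 1: "\<phi> t = (x / g) *\<^sub>R a + (y / g) *\<^sub>R b"
      by (simp add: \<phi>_def s_def x_def[symmetric] y_def[symmetric] g_def e_def algebra_simps)
    have 2: "\<phi>' t = (k * (- y / g - d x y * x / g\<^sup>2)) *\<^sub>R a + (k * (x / g - d x y * y / g\<^sup>2)) *\<^sub>R b"
      by (simp add: \<phi>'_def s'_def x_def[symmetric] y_def[symmetric] g_def k_def algebra_simps)
    have "(x / g) * (k * (x / g - d x y * y / g\<^sup>2)) - (y / g) * (k * (- y / g - d x y * x / g\<^sup>2))
        = k * (x\<^sup>2 + y\<^sup>2) / g\<^sup>2"
      using g by (simp add: field_simps power2_eq_square)
    also have "\<dots> > 0" using g k xy by simp
    finally show ?thesis unfolding pos_oriented_def using 1 2 by blast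
  qed
  then have "unit_circle_param N a b \<phi>"
    unfolding unit_circle_param_def using arc rng vd by simp
  moreover have "\<phi> 0 = a"
    using Na by (simp add: \<phi>_def \<theta>(1) s_def e_def)
  ultimately show ?thesis using that by blast
qed

end

section \<open>Circular curvature in a normal plane\<close>

lemma has_vector_derivative_imp_quotient_tendsto:
  fixes z :: "real \<Rightarrow> 'a::euclidean_space"
  assumes "(z has_vector_derivative D) (at 0)" "z 0 = 0"
  shows "((\<lambda>r. z r /\<^sub>R r) \<longlongrightarrow> D) (at 0)"
  unfolding tendsto_componentwise_iff[where f = "\<lambda>r. z r /\<^sub>R r"]
proof
  fix i :: 'a assume "i \<in> Basis"
  have "((\<lambda>r. z r \<bullet> i) has_real_derivative D \<bullet> i) (at 0)"
    using bounded_linear.has_vector_derivative[OF bounded_linear_inner_left assms(1)]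
    by (simp add: has_real_derivative_iff_has_vector_derivative)
  then show "((\<lambda>r. (z r /\<^sub>R r) \<bullet> i) \<longlongrightarrow> D \<bullet> i) (at 0)"
    using assms(2) by (simp add: DERIV_def divide_inverse mult.commute)
qed

locale normal_plane = smooth_norm +
  fixes a X :: "real^3"
  assumes Na: "N a = 1" and NX: "N X = 1" and nX: "n a \<bullet> X = 0"
begin

lemma a0: "a \<noteq> 0" using Na is_norm by auto

lemma X0: "X \<noteq> 0" using NX is_norm by auto

lemma na: "n a \<bullet> a = 1" using n_self[OF a0] Na by simp

lemma coordinates: "n a \<bullet> (x *\<^sub>R a + y *\<^sub>R X) = x"
  by (simp add: inner_add_right na nX)

lemma basis_independent:
  assumes "x *\<^sub>R a + y *\<^sub>R X = 0"
  shows "x = 0 \<and> y = 0"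
  using coordinates[of x y] assms X0 by simp

lemma in_span_iff: "z \<in> span {a, X} \<longleftrightarrow> (\<exists>x y. z = x *\<^sub>R a + y *\<^sub>R X)"
proof
  assume "z \<in> span {a, X}"
  then show "\<exists>x y. z = x *\<^sub>R a + y *\<^sub>R X"
    by (auto simp: span_insert algebra_simps span_singleton)
next
  assume "\<exists>x y. z = x *\<^sub>R a + y *\<^sub>R X"
  then show "z \<in> span {a, X}"
    by (auto intro!: span_add span_scale intro: span_base)
qed

lemma dim_plane: "dim (span {a, X}) = 2"
proof -
  have "a \<notin> span {X}"
  proof
    assume "a \<in> span {X}"
    then obtain k where "a = k *\<^sub>R X" by (auto simp: span_singleton)
    then have "n a \<bullet> a = k * (n a \<bullet> X)" by (metis inner_scaleR_right)
    then show False by (simp add: na nX)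
  qed
  then show ?thesis using X0 by (simp add: dim_insert)
qed

text \<open>The functional \<open>n z\<close> supports the unit ball at \<open>z\<close>; within the plane it is represented by its
  orthogonal projection.\<close>

lemma birkhoff_orthogonal_in_plane:
  assumes z: "z \<in> span {a, X}" "N z = 1" and g: "g \<in> span {a, X}" "g \<noteq> 0" "n z \<bullet> g = 0"
  shows "birkhoff_orthogonal_in N (span {a, X}) z (span {g})"
proof -
  have z0: "z \<noteq> 0" using z(2) is_norm by auto
  obtain k k' where k: "k \<in> span {a, X}" and k': "\<And>w. w \<in> span {a, X} \<Longrightarrow> orthogonal k' w"
    and nz: "n z = k + k'"
    using orthogonal_subspace_decomp_exists by metis
  have k_eq: "k \<bullet> w = n z \<bullet> w" if "w \<in> span {a, X}" for w
    using k'[OF that] by (simp add: nz inner_add_left orthogonal_def)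
  have kz: "k \<bullet> z = 1" using k_eq[OF z(1)] n_self[OF z0] z(2) by simp
  have "k \<bullet> y = 0" if "y \<in> span {g}" for y
    using that k_eq[OF g(1)] g(3) by (auto simp: span_singleton)
  moreover have "k \<bullet> y \<le> k \<bullet> (z /\<^sub>R N z)" if "y \<in> unit_ball N \<inter> span {a, X}" for y
    using that k_eq[of y] n_le[OF z0, of y] kz z(2) by (simp add: unit_ball_def)
  moreover have "span {g} \<subseteq> span {a, X}" using g(1) by (simp add: span_minimal)
  moreover have "k \<noteq> 0" using kz by auto
  moreover have "dim (span {g}) = 1" using g(2) by (simp add: dim_insert)
  ultimately show ?thesis
    unfolding birkhoff_orthogonal_in_def
    using z(1) z0 k dim_plane by (auto simp del: dim_span intro!: bexI[of _ k])
qed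

context
  fixes \<phi> :: "real \<Rightarrow> real^3"
  assumes \<phi>: "unit_circle_param N a X \<phi>"
begin

lemma circle_derivative: "(\<phi> has_vector_derivative vector_derivative \<phi> (at t)) (at t)"
  using \<phi> unfolding unit_circle_param_def arc_length_on_def C1_differentiable_on_eq
  by (simp add: vector_derivative_works)

lemma circle_norm: "N (\<phi> t) = 1"
  using \<phi> unfolding unit_circle_param_def unit_sphere_def by blast

lemma circle_nonzero: "\<phi> t \<noteq> 0"
  using circle_norm[of t] is_norm by auto

lemma circle_in_span: "\<phi> t \<in> span {a, X}"
  using \<phi> unfolding unit_circle_param_def by blast

lemma circle_speed: "N (vector_derivative \<phi> (at t)) = 1"
  using \<phi> unfolding unit_circle_param_def arc_length_on_def by blast

lemma circle_oriented: "pos_oriented a X (\<phi> t) (vector_derivative \<phi> (at t))"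
  using \<phi> unfolding unit_circle_param_def by blast

lemma circle_tangent: "n (\<phi> t) \<bullet> vector_derivative \<phi> (at t) = 0"
proof -
  have "((\<lambda>t. N (\<phi> t)) has_real_derivative n (\<phi> t) \<bullet> vector_derivative \<phi> (at t)) (at t)"
    by (rule N_compose_derivative[OF circle_derivative circle_nonzero])
  then show ?thesis using DERIV_unique[OF _ DERIV_const[of 1]] by (simp add: circle_norm)
qed

lemma circle_coordinates:
  obtains x1 x2 y1 y2 where "\<phi> t = x1 *\<^sub>R a + x2 *\<^sub>R X" "vector_derivative \<phi> (at t) = y1 *\<^sub>R a + y2 *\<^sub>R X"
    "x1 * y2 - x2 * y1 > 0"
    "x1 * (n (\<phi> t) \<bullet> a) + x2 * (n (\<phi> t) \<bullet> X) = 1" "y1 * (n (\<phi> t) \<bullet> a) + y2 * (n (\<phi> t) \<bullet> X) = 0"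
proof -
  obtain x1 x2 y1 y2 where 1: "\<phi> t = x1 *\<^sub>R a + x2 *\<^sub>R X"
    "vector_derivative \<phi> (at t) = y1 *\<^sub>R a + y2 *\<^sub>R X" "x1 * y2 - x2 * y1 > 0"
    using circle_oriented unfolding pos_oriented_def by blast
  have "n (\<phi> t) \<bullet> (x1 *\<^sub>R a + x2 *\<^sub>R X) = 1"
    using n_self[OF circle_nonzero, of t] circle_norm[of t] unfolding 1(1)[symmetric] by simp
  moreover have "n (\<phi> t) \<bullet> (y1 *\<^sub>R a + y2 *\<^sub>R X) = 0"
    using circle_tangent[of t] unfolding 1(2) .
  ultimately show ?thesis using that[OF 1] by (simp add: inner_add_right)
qed

text \<open>Where \<open>n (\<phi> t) \<bullet> a > 0\<close>, the orientation forces the tangent to have a positive \<open>X\<close>-component.\<close>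

lemma circle_direction:
  assumes "n (\<phi> t) \<bullet> a > 0"
  shows "\<exists>k>0. vector_derivative \<phi> (at t) = k *\<^sub>R (X - ((n (\<phi> t) \<bullet> X) / (n (\<phi> t) \<bullet> a)) *\<^sub>R a)"
proof -
  obtain x1 x2 y1 y2 where c: "vector_derivative \<phi> (at t) = y1 *\<^sub>R a + y2 *\<^sub>R X"
    "x1 * y2 - x2 * y1 > 0"
    "x1 * (n (\<phi> t) \<bullet> a) + x2 * (n (\<phi> t) \<bullet> X) = 1" "y1 * (n (\<phi> t) \<bullet> a) + y2 * (n (\<phi> t) \<bullet> X) = 0"
    by (rule circle_coordinates)
  define \<alpha> where "\<alpha> = n (\<phi> t) \<bullet> a"
  define \<beta> where "\<beta> = n (\<phi> t) \<bullet> X"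
  have \<alpha>: "\<alpha> > 0" using assms by (simp add: \<alpha>_def)
  have y1: "y1 = - (\<beta> / \<alpha>) * y2"
    using c(4) \<alpha> unfolding \<alpha>_def[symmetric] \<beta>_def[symmetric] by (simp add: field_simps)
  have "\<alpha> * (x1 * y2 - x2 * y1) = y2 * (x1 * \<alpha> + x2 * \<beta>)"
    using \<alpha> by (simp add: y1 field_simps)
  also have "\<dots> = y2" using c(3) unfolding \<alpha>_def \<beta>_def by simp
  finally have "y2 > 0" using c(2) \<alpha> by (metis mult_pos_pos)
  moreover have "vector_derivative \<phi> (at t) = y2 *\<^sub>R (X - (\<beta> / \<alpha>) *\<^sub>R a)"
    unfolding c(1) y1 by (simp add: algebra_simps)
  ultimately show ?thesis unfolding \<alpha>_def \<beta>_def by blast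
qed

text \<open>The slope of the normal along the circle is increasing: its derivative has the sign of a
  Wronskian, which is computed in the moving basis \<open>(\<phi> t, \<phi>' t)\<close> instead of \<open>(a, X)\<close>.\<close>

lemma circle_slope_derivative:
  assumes pos: "n (\<phi> t) \<bullet> a > 0"
    and def: "\<And>v. v \<noteq> 0 \<Longrightarrow> n (\<phi> t) \<bullet> v = 0 \<Longrightarrow> n' (\<phi> t) v \<bullet> v > 0"
  shows "\<exists>m'>0. ((\<lambda>t. (n (\<phi> t) \<bullet> X) / (n (\<phi> t) \<bullet> a)) has_real_derivative m') (at t)"
proof -
  obtain x1 x2 y1 y2 where x: "\<phi> t = x1 *\<^sub>R a + x2 *\<^sub>R X" and y: "vector_derivative \<phi> (at t) = y1 *\<^sub>R a + y2 *\<^sub>R X"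
    and c: "x1 * y2 - x2 * y1 > 0"
    "x1 * (n (\<phi> t) \<bullet> a) + x2 * (n (\<phi> t) \<bullet> X) = 1" "y1 * (n (\<phi> t) \<bullet> a) + y2 * (n (\<phi> t) \<bullet> X) = 0"
    by (rule circle_coordinates)
  define z where "z = n' (\<phi> t) (vector_derivative \<phi> (at t))"
  have Dz: "((\<lambda>t. n (\<phi> t)) has_vector_derivative z) (at t)"
    unfolding z_def by (rule n_compose_derivative[OF circle_derivative circle_nonzero])
  have D: "((\<lambda>t. n (\<phi> t) \<bullet> w) has_real_derivative z \<bullet> w) (at t)" for w
    using bounded_linear.has_vector_derivative[OF bounded_linear_inner_left Dz]
    by (simp add: has_real_derivative_iff_has_vector_derivative)
  have "vector_derivative \<phi> (at t) \<noteq> 0" using circle_speed[of t] is_norm by auto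
  then have b: "z \<bullet> vector_derivative \<phi> (at t) > 0"
    unfolding z_def using def circle_tangent by blast
  have z0: "z \<bullet> \<phi> t = 0" unfolding z_def by (rule n'_self[OF circle_nonzero])
  define \<alpha> where "\<alpha> = n (\<phi> t) \<bullet> a"
  define \<beta> where "\<beta> = n (\<phi> t) \<bullet> X"
  have b': "y1 * (z \<bullet> a) + y2 * (z \<bullet> X) > 0" using b by (simp add: y inner_add_right)
  have z0': "x1 * (z \<bullet> a) + x2 * (z \<bullet> X) = 0" using z0 by (simp add: x inner_add_right)
  have "(x1 * y2 - x2 * y1) * (\<alpha> * (z \<bullet> X) - \<beta> * (z \<bullet> a))
      = (x1 * \<alpha> + x2 * \<beta>) * (y1 * (z \<bullet> a) + y2 * (z \<bullet> X))
        - (x1 * (z \<bullet> a) + x2 * (z \<bullet> X)) * (y1 * \<alpha> + y2 * \<beta>)"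
    by (simp add: algebra_simps)
  also have "\<dots> > 0" using c(2) z0' b' by (simp add: \<alpha>_def \<beta>_def)
  finally have W: "\<alpha> * (z \<bullet> X) - \<beta> * (z \<bullet> a) > 0" using c(1) by (simp add: zero_less_mult_iff)
  have "((\<lambda>t. (n (\<phi> t) \<bullet> X) / (n (\<phi> t) \<bullet> a)) has_real_derivative
      ((z \<bullet> X) * \<alpha> - \<beta> * (z \<bullet> a)) / (\<alpha> * \<alpha>)) (at t)"
    unfolding \<alpha>_def \<beta>_def using pos by (intro DERIV_divide D) auto
  moreover have "((z \<bullet> X) * \<alpha> - \<beta> * (z \<bullet> a)) / (\<alpha> * \<alpha>) > 0"
    using W pos by (simp add: mult.commute \<alpha>_def)
  ultimately show ?thesis by blast
qed

end

text \<open>The sphere would contain the segment between two points at which the same functional supports the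
  ball.\<close>

lemma touching_point_unique:
  assumes sc: "\<And>x y. x \<noteq> y \<Longrightarrow> \<not> closed_segment x y \<subseteq> unit_sphere N"
    and z: "N z = 1" "n a \<bullet> z = 1"
  shows "z = a"
proof (rule ccontr)
  assume "z \<noteq> a"
  moreover have "closed_segment z a \<subseteq> unit_sphere N"
  proof
    fix w assume "w \<in> closed_segment z a"
    then obtain u where u: "0 \<le> u" "u \<le> 1" and w: "w = (1 - u) *\<^sub>R z + u *\<^sub>R a"
      by (auto simp: closed_segment_def)
    have "n a \<bullet> w = 1" unfolding w by (simp add: inner_add_right na z)
    then have "1 \<le> N w" using n_le[OF a0, of w] by simp
    moreover have "N w \<le> 1"
      using is_norm_triangle[OF is_norm, of "(1 - u) *\<^sub>R z" "u *\<^sub>R a"] u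
      unfolding w by (simp add: is_norm_scaleR[OF is_norm] z Na)
    ultimately show "w \<in> unit_sphere N" by (simp add: unit_sphere_def)
  qed
  ultimately show False using sc by blast
qed

text \<open>The tangent \<open>G r\<close> of the curve is annihilated both by the normal of the circle at \<open>t r\<close> and by
  the normal \<open>n (e r)\<close> of the surface. The difference of these normals vanishes at \<open>0\<close>; dividing it
  by \<open>r\<close> gives in the limit \<open>n' a (\<kappa> *\<^sub>R X - E) \<bullet> X = 0\<close>. A limit of quotients takes the place of
  differentiating the two relations because the curve is only of class \<open>C\<^sup>1\<close>.\<close>

lemma circular_curvature_determined:
  assumes sc: "\<And>x y. x \<noteq> y \<Longrightarrow> \<not> closed_segment x y \<subseteq> unit_sphere N"
    and \<phi>: "unit_circle_param N a X \<phi>"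
    and e: "(e has_vector_derivative E) (at 0)" "e 0 = a"
    and G: "isCont G 0" "G 0 = X"
    and eG: "\<forall>\<^sub>F r in nhds 0. n (e r) \<bullet> G r = 0"
    and tG: "\<forall>\<^sub>F r in nhds 0. vector_derivative \<phi> (at (t r)) = G r"
    and t: "(t has_real_derivative \<kappa>) (at 0)"
  shows "\<kappa> * (n' a X \<bullet> X) = n' a E \<bullet> X"
proof -
  have tX: "vector_derivative \<phi> (at (t 0)) = X" using eventually_nhds_x_imp_x[OF tG] G(2) by simp
  have \<phi>a: "\<phi> (t 0) = a"
  proof -
    \<comment> \<open>The normals at \<open>\<phi> (t 0)\<close> and at \<open>a\<close> are proportional in the plane, and the orientation excludes
      the antipode; the two inequalities for supporting functionals make the factor \<open>1\<close>.\<close>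
    obtain x1 x2 y1 y2 where x: "\<phi> (t 0) = x1 *\<^sub>R a + x2 *\<^sub>R X"
      and y: "vector_derivative \<phi> (at (t 0)) = y1 *\<^sub>R a + y2 *\<^sub>R X"
      and c: "x1 * y2 - x2 * y1 > 0"
        "x1 * (n (\<phi> (t 0)) \<bullet> a) + x2 * (n (\<phi> (t 0)) \<bullet> X) = 1"
      by (rule circle_coordinates[OF \<phi>])
    have "y1 *\<^sub>R a + (y2 - 1) *\<^sub>R X = 0" using y tX by (simp add: algebra_simps)
    then have y12: "y1 = 0" "y2 = 1" using basis_independent by fastforce+
    have x1: "x1 > 0" using c(1) y12 by simp
    have "n (\<phi> (t 0)) \<bullet> X = 0" using circle_tangent[OF \<phi>, of "t 0"] tX by simp
    then have "x1 * (n (\<phi> (t 0)) \<bullet> a) = 1" using c(2) by simp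
    moreover have "n (\<phi> (t 0)) \<bullet> a \<le> 1" using n_le[OF circle_nonzero[OF \<phi>], of "t 0" a] Na by simp
    ultimately have "x1 \<ge> 1" using x1 by (metis mult_left_mono mult.right_neutral less_imp_le)
    moreover have nz: "n a \<bullet> \<phi> (t 0) = x1" unfolding x by (rule coordinates)
    moreover have "n a \<bullet> \<phi> (t 0) \<le> 1" using n_le[OF a0, of "\<phi> (t 0)"] circle_norm[OF \<phi>] by simp
    ultimately show ?thesis using touching_point_unique[OF sc circle_norm[OF \<phi>, of "t 0"]] by simp
  qed
  define z where "z r = n (\<phi> (t r)) - n (e r)" for r
  have "((\<lambda>r. \<phi> (t r)) has_vector_derivative \<kappa> *\<^sub>R X) (at 0)"
    using vector_diff_chain_at[OF t[unfolded has_real_derivative_iff_has_vector_derivative]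
        circle_derivative[OF \<phi>]] tX by (simp add: o_def)
  from n_compose_derivative[OF this circle_nonzero[OF \<phi>]]
  have 1: "((\<lambda>r. n (\<phi> (t r))) has_vector_derivative n' a (\<kappa> *\<^sub>R X)) (at 0)" by (simp add: \<phi>a)
  have 2: "((\<lambda>r. n (e r)) has_vector_derivative n' a E) (at 0)"
    using n_compose_derivative[OF e(1)] e(2) a0 by simp
  have Dz: "(z has_vector_derivative n' a (\<kappa> *\<^sub>R X) - n' a E) (at 0)"
    unfolding z_def[abs_def] by (rule has_vector_derivative_diff[OF 1 2])
  have z0: "z 0 = 0" by (simp add: z_def \<phi>a e(2))
  have "((\<lambda>r. (z r /\<^sub>R r) \<bullet> G r) \<longlongrightarrow> (n' a (\<kappa> *\<^sub>R X) - n' a E) \<bullet> X) (at 0)"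
    using has_vector_derivative_imp_quotient_tendsto[OF Dz z0] G by (intro tendsto_inner) (auto simp: isCont_def)
  moreover have "\<forall>\<^sub>F r in at 0. (z r /\<^sub>R r) \<bullet> G r = 0"
  proof -
    have "\<forall>\<^sub>F r in nhds 0. z r \<bullet> G r = 0"
      using eG tG
    proof eventually_elim
      case (elim r)
      then show ?case using circle_tangent[OF \<phi>, of "t r"] by (simp add: z_def inner_diff_left)
    qed
    then show ?thesis by (simp add: eventually_at_filter eventually_mono)
  qed
  ultimately have "((\<lambda>r. 0) \<longlongrightarrow> (n' a (\<kappa> *\<^sub>R X) - n' a E) \<bullet> X) (at (0::real))"
    by (rule Lim_transform_eventually)
  then have "(n' a (\<kappa> *\<^sub>R X) - n' a E) \<bullet> X = 0"
    using tendsto_const_iff[of "at (0::real)" "0::real"] by simp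
  then show ?thesis by (simp add: inner_diff_left linear_cmul[OF n'_linear[OF a0]])
qed

text \<open>A tangent direction \<open>X - \<mu> *\<^sub>R a\<close> is annihilated by the functional \<open>n (\<phi> t)\<close> whose slope \<open>m t\<close> equals
  \<open>\<mu>\<close>. As \<open>m\<close> increases strictly near \<open>0\<close>, \<open>t\<close> is found as \<open>m\<^sup>-\<^sup>1 (\<mu> r)\<close>, and it is differentiable
  because the slope \<open>\<mu> r\<close> of the tangent is expressed through the normals \<open>n (e r)\<close> of the surface.\<close>

lemma circular_curvature_exists:
  assumes def: "\<And>q v. N q = 1 \<Longrightarrow> v \<noteq> 0 \<Longrightarrow> n q \<bullet> v = 0 \<Longrightarrow> n' q v \<bullet> v > 0"
    and e: "(e has_vector_derivative E) (at 0)" "e 0 = a"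
    and speed: "\<forall>\<^sub>F r in nhds 0. N (vector_derivative \<gamma> (at r)) = 1"
    and direction: "\<forall>\<^sub>F r in nhds 0. \<exists>l>0. vector_derivative \<gamma> (at r)
        = l *\<^sub>R (X - ((n (e r) \<bullet> X) / (n (e r) \<bullet> a)) *\<^sub>R a)"
  shows "\<exists>\<kappa>. has_circular_curvature N a X \<gamma> 0 \<kappa>"
proof -
  obtain \<phi> where \<phi>: "unit_circle_param N a X \<phi>" and \<phi>0: "\<phi> 0 = a"
    using unit_circle_param_exists[OF basis_independent Na] by blast
  define m where "m t = (n (\<phi> t) \<bullet> X) / (n (\<phi> t) \<bullet> a)" for t
  have m0: "m 0 = 0" by (simp add: m_def \<phi>0 nX)
  have "isCont (\<lambda>t. n (\<phi> t) \<bullet> a) 0"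
    using n_compose_derivative[OF circle_derivative[OF \<phi>] circle_nonzero[OF \<phi>]]
    by (intro continuous_intros has_vector_derivative_continuous) auto
  moreover have "n (\<phi> 0) \<bullet> a > 0" by (simp add: \<phi>0 na)
  ultimately have "\<forall>\<^sub>F t in nhds 0. n (\<phi> t) \<bullet> a > 0"
    by (intro order_tendstoD(1)[where y = "n (\<phi> 0) \<bullet> a"]) (simp_all add: isCont_def tendsto_nhds_iff)
  then obtain d0 where d0: "d0 > 0" "\<And>t. \<bar>t\<bar> < d0 \<Longrightarrow> n (\<phi> t) \<bullet> a > 0"
    unfolding eventually_nhds_metric dist_real_def by auto
  define d where "d = d0 / 2"
  have d: "d > 0" using d0 by (simp add: d_def)
  have \<alpha>: "n (\<phi> t) \<bullet> a > 0" if "\<bar>t\<bar> \<le> d" for t using d0 that by (simp add: d_def)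
  have Dm: "\<exists>m'>0. (m has_real_derivative m') (at t)" if "\<bar>t\<bar> \<le> d" for t
    using circle_slope_derivative[OF \<phi> \<alpha>[OF that] def[OF circle_norm[OF \<phi>]]]
    unfolding m_def[abs_def] by blast
  have mc: "isCont m t" if "\<bar>t\<bar> \<le> d" for t using Dm[OF that] DERIV_isCont by blast
  have mono: "m s < m t" if "- d \<le> s" "s < t" "t \<le> d" for s t
  proof (rule DERIV_pos_imp_increasing[OF that(2)])
    show "\<exists>y. (m has_real_derivative y) (at x) \<and> y > 0" if "s \<le> x" "x \<le> t" for x
    proof -
      have "\<bar>x\<bar> \<le> d" using that \<open>- d \<le> s\<close> \<open>t \<le> d\<close> by linarith
      then show ?thesis using Dm by blast
    qed
  qed
  have injm: "inj_on m {- d..d}"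
  proof (rule linorder_inj_onI)
    show "m s \<noteq> m t" if "s < t" "s \<in> {- d..d}" "t \<in> {- d..d}" for s t
      using mono[of s t] that by simp
  qed auto
  define g where "g = the_inv_into {- d..d} m"
  have gm: "g (m t) = t" if "\<bar>t\<bar> \<le> d" for t
    unfolding g_def by (rule the_inv_into_f_f[OF injm]) (use that in auto)
  have mg: "\<bar>g y\<bar> \<le> d \<and> m (g y) = y" if "m (- d) < y" "y < m d" for y
  proof -
    have "\<exists>t. - d \<le> t \<and> t \<le> d \<and> m t = y"
      by (rule IVT) (use that mc d in auto)
    then obtain t where "- d \<le> t" "t \<le> d" "m t = y" by blast
    then show ?thesis using gm[of t] by auto
  qed
  have g0: "g 0 = 0" using gm[of 0] m0 d by simp
  have lt: "m (- d) < 0" "0 < m d" using mono[of "- d" 0] mono[of 0 d] d m0 by auto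
  have gc: "isCont g 0" using isCont_inverse_function[of d 0 g m] d gm mc m0 by simp
  obtain m' where m': "m' > 0" "(m has_real_derivative m') (at 0)" using Dm[of 0] d by auto
  have Dg: "(g has_real_derivative inverse m') (at 0)"
    using DERIV_inverse_function[of m m' g 0 "m (- d)" "m d"] m' g0 lt mg gc by simp
  define \<mu> where "\<mu> r = (n (e r) \<bullet> X) / (n (e r) \<bullet> a)" for r
  have De: "((\<lambda>r. n (e r) \<bullet> w) has_real_derivative n' a E \<bullet> w) (at 0)" for w
    using bounded_linear.has_vector_derivative[OF bounded_linear_inner_left
        n_compose_derivative[OF e(1)], of w] e(2) a0
    by (simp add: has_real_derivative_iff_has_vector_derivative)
  have \<mu>0: "\<mu> 0 = 0" by (simp add: \<mu>_def e(2) nX)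
  obtain \<mu>' where D\<mu>: "(\<mu> has_real_derivative \<mu>') (at 0)"
    using that[unfolded \<mu>_def[abs_def], OF DERIV_divide[OF De[of X] De[of a]]] e(2) na by simp
  define t where "t r = g (\<mu> r)" for r
  have Dt: "(t has_real_derivative inverse m' * \<mu>') (at 0)"
    unfolding t_def[abs_def] using DERIV_chain2[of g "inverse m'" \<mu> 0 \<mu>' UNIV] Dg D\<mu> \<mu>0 by simp
  have "(\<mu> \<longlongrightarrow> \<mu> 0) (nhds 0)"
    using DERIV_isCont[OF D\<mu>] by (simp add: isCont_def tendsto_nhds_iff)
  then have "\<forall>\<^sub>F r in nhds 0. m (- d) < \<mu> r" "\<forall>\<^sub>F r in nhds 0. \<mu> r < m d"
    using lt \<mu>0 by (auto intro: order_tendstoD)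
  then have "\<forall>\<^sub>F r in nhds 0. \<phi> (t r) \<in> unit_sphere N \<inter> span {a, X} \<and>
     birkhoff_orthogonal_in N (span {a, X}) (\<phi> (t r)) (span {vector_derivative \<gamma> (at r)}) \<and>
     pos_oriented a X (\<phi> (t r)) (vector_derivative \<gamma> (at r)) \<and>
     \<phi> (t r) = \<phi> (t r) \<and> vector_derivative \<phi> (at (t r)) = vector_derivative \<gamma> (at r)"
    using speed direction
  proof eventually_elim
    case (elim r)
    have tr: "\<bar>t r\<bar> \<le> d" "m (t r) = \<mu> r" using mg[OF elim(1,2)] by (simp_all add: t_def)
    let ?w = "X - \<mu> r *\<^sub>R a"
    obtain k where k: "k > 0" "vector_derivative \<phi> (at (t r)) = k *\<^sub>R ?w"
      using circle_direction[OF \<phi> \<alpha>[OF tr(1)]] tr(2) by (auto simp: m_def)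
    obtain l where l: "l > 0" "vector_derivative \<gamma> (at r) = l *\<^sub>R ?w"
      using elim(4) by (auto simp: \<mu>_def)
    have "k * N ?w = 1" using circle_speed[OF \<phi>, of "t r"] k by (simp add: is_norm_scaleR[OF is_norm])
    moreover have "l * N ?w = 1" using elim(3) l by (simp add: is_norm_scaleR[OF is_norm])
    ultimately have "k = l" by (metis mult_cancel_right mult_zero_right zero_neq_one)
    then have eq: "vector_derivative \<phi> (at (t r)) = vector_derivative \<gamma> (at r)" using k l by simp
    have "?w = (- \<mu> r) *\<^sub>R a + 1 *\<^sub>R X" by simp
    then have "?w \<in> span {a, X}" unfolding in_span_iff by blast
    then have "vector_derivative \<gamma> (at r) \<in> span {a, X}" using l span_scale by metis
    moreover have "vector_derivative \<gamma> (at r) \<noteq> 0" using elim(3) is_norm by auto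
    ultimately have "birkhoff_orthogonal_in N (span {a, X}) (\<phi> (t r)) (span {vector_derivative \<gamma> (at r)})"
      using birkhoff_orthogonal_in_plane[OF circle_in_span[OF \<phi>] circle_norm[OF \<phi>]]
        circle_tangent[OF \<phi>, of "t r"] eq by simp
    then show ?case
      using circle_norm[OF \<phi>] circle_in_span[OF \<phi>] circle_oriented[OF \<phi>, of "t r"] eq
      by (simp add: unit_sphere_def)
  qed
  then show ?thesis unfolding has_circular_curvature_def using \<phi> Dt
    by (intro exI[of _ "inverse m' * \<mu>'"] exI[of _ \<phi>] exI[of _ "\<lambda>r. \<phi> (t r)"] exI[of _ t] conjI)
qed

end

section \<open>A surface patch with its Birkhoff normal\<close>

text \<open>\<open>F\<close> is a parametrization near the point of interest and \<open>E\<close> the Birkhoff normal field in the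
  same coordinates; \<open>n (E u)\<close> is a Euclidean normal of the tangent plane.\<close>

locale birkhoff_patch = smooth_norm +
  fixes F E :: "real^2 \<Rightarrow> real^3" and \<Omega> :: "(real^2) set" and u0 :: "real^2"
  assumes open_\<Omega>: "open \<Omega>" and u0: "u0 \<in> \<Omega>" and F: "smooth_on \<Omega> F" and E: "smooth_on \<Omega> E"
    and NE: "\<And>u. u \<in> \<Omega> \<Longrightarrow> N (E u) = 1"
    and nF: "\<And>u v. u \<in> \<Omega> \<Longrightarrow> n (E u) \<bullet> frechet_derivative F (at u) v = 0"
    and injF: "inj (frechet_derivative F (at u0))"
begin

abbreviation "D \<equiv> frechet_derivative F (at u0)"
abbreviation "DE \<equiv> frechet_derivative E (at u0)"
abbreviation "a \<equiv> E u0"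

lemma E0: "u \<in> \<Omega> \<Longrightarrow> E u \<noteq> 0"
  using NE[of u] is_norm by auto

lemma na: "n a \<bullet> a = 1"
  using n_self[OF E0[OF u0]] NE[OF u0] by simp

lemma linear_D: "linear D" and linear_DE: "linear DE"
  using smooth_on_has_derivative[OF F u0] smooth_on_has_derivative[OF E u0] has_derivative_linear
  by blast+

lemma range_D: "range D = {z. n a \<bullet> z = 0}"
  using range_eq_hyperplane[OF linear_D injF _ nF[OF u0]] na by force

lemma nDE: "n a \<bullet> DE v = 0"
proof -
  have "((\<lambda>u. N (E u)) has_derivative (\<lambda>v. n a \<bullet> DE v)) (at u0)"
    using diff_chain_at[OF smooth_on_has_derivative[OF E u0] N_derivative[OF E0[OF u0]]]
    by (simp add: o_def)
  moreover have "((\<lambda>u. N (E u)) has_derivative (\<lambda>v. 0)) (at u0)"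
    by (rule has_derivative_transform_within_open[OF has_derivative_const[of 1] open_\<Omega> u0])
      (simp add: NE)
  ultimately have "(\<lambda>v. n a \<bullet> DE v) = (\<lambda>v. 0)" by (rule has_derivative_unique)
  then show ?thesis by (rule fun_cong)
qed

text \<open>Differentiating \<open>n (E u) \<bullet> \<partial>\<^sub>v F (u) = 0\<close> along \<open>w\<close> expresses the form by a second derivative
  of \<open>F\<close>.\<close>

lemma shape_symmetric: "n' a (DE w) \<bullet> D v = n' a (DE v) \<bullet> D w"
proof -
  define F2 where "F2 v = frechet_derivative (\<lambda>u. frechet_derivative F (at u) v) (at u0)" for v
  have "n' a (DE w) \<bullet> D v = - (n a \<bullet> F2 v w)" for v w
  proof -
    have 1: "((\<lambda>u. n (E u)) has_derivative (\<lambda>w. n' a (DE w))) (at u0)"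
      using diff_chain_at[OF smooth_on_has_derivative[OF E u0] n_derivative[OF E0[OF u0]]]
      by (simp add: o_def)
    have 2: "((\<lambda>u. frechet_derivative F (at u) v) has_derivative F2 v) (at u0)"
      unfolding F2_def by (rule smooth_on_has_derivative[OF smooth_on_frechet_derivative[OF F] u0])
    have "((\<lambda>u. n (E u) \<bullet> frechet_derivative F (at u) v) has_derivative
        (\<lambda>w. n a \<bullet> F2 v w + n' a (DE w) \<bullet> D v)) (at u0)"
      by (rule has_derivative_inner[OF 1 2])
    moreover have "((\<lambda>u. n (E u) \<bullet> frechet_derivative F (at u) v) has_derivative (\<lambda>w. 0)) (at u0)"
      by (rule has_derivative_transform_within_open[OF has_derivative_const[of 0] open_\<Omega> u0])
        (simp add: nF)
    ultimately have "(\<lambda>w. n a \<bullet> F2 v w + n' a (DE w) \<bullet> D v) = (\<lambda>w. 0)"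
      by (rule has_derivative_unique)
    from fun_cong[OF this, of w] show ?thesis by simp
  qed
  moreover have "F2 v w = F2 w v"
    unfolding F2_def by (rule second_derivative_symmetric[OF F open_\<Omega> u0])
  ultimately show ?thesis by simp
qed

text \<open>Near \<open>u0\<close> the surface is a graph over its tangent plane in the direction \<open>a\<close>: composing \<open>F\<close>
  with the projection along \<open>a\<close> gives a local diffeomorphism of the parameter plane, here normalized to
  have the identity as its derivative at \<open>u0\<close>.\<close>

lemma graph_coordinates:
  obtains P Z V \<Psi> where "linear P" "\<And>v. P (D v) = v" "P a = 0" "\<And>z. D (P z) + (n a \<bullet> z) *\<^sub>R a = z"
    "open Z" "Z \<subseteq> \<Omega>" "u0 \<in> Z" "open V" "0 \<in> V" "homeomorphism Z V (\<lambda>u. P (F u - F u0)) \<Psi>"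
    "\<And>y. y \<in> V \<Longrightarrow> \<Psi> differentiable (at y)"
proof -
  obtain g where g: "linear g" "g \<circ> D = id"
    using linear_injective_left_inverse[OF linear_D injF] by blast
  have gD: "g (D v) = v" for v using g(2) by (metis comp_apply id_apply)
  define P where "P z = g (z - (n a \<bullet> z) *\<^sub>R a)" for z
  have P: "linear P" unfolding P_def
    by (rule linearI) (simp_all add: linear_diff[OF g(1)] linear_add[OF g(1)] linear_cmul[OF g(1)]
        inner_add_right algebra_simps)
  have PD: "P (D v) = v" for v using nF[OF u0, of v] by (simp add: P_def gD)
  have Pa: "P a = 0" by (simp add: P_def na linear_0[OF g(1)])
  have DP: "D (P z) + (n a \<bullet> z) *\<^sub>R a = z" for z
  proof -
    have "z - (n a \<bullet> z) *\<^sub>R a \<in> range D" unfolding range_D by (simp add: inner_diff_right na)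
    then obtain v where v: "z - (n a \<bullet> z) *\<^sub>R a = D v" by blast
    then have "P z = v" by (simp add: P_def gD)
    then show ?thesis using v by (simp add: diff_eq_eq)
  qed
  have blP: "bounded_linear P" using P linear_conv_bounded_linear by blast
  define \<Phi> where "\<Phi> u = P (F u - F u0)" for u
  define d where "d u v = P (frechet_derivative F (at u) v)" for u v
  have D\<Phi>: "(\<Phi> has_derivative d u) (at u)" if "u \<in> \<Omega>" for u
  proof -
    have "((\<lambda>u. F u - F u0) has_derivative frechet_derivative F (at u)) (at u)"
      using has_derivative_diff[OF smooth_on_has_derivative[OF F that] has_derivative_const] by simp
    from bounded_linear.has_derivative[OF blP this] show ?thesis
      by (simp add: \<Phi>_def[abs_def] d_def[abs_def])
  qed
  have bld: "bounded_linear (d u)" if "u \<in> \<Omega>" for u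
    using D\<Phi>[OF that] by (rule has_derivative_bounded_linear)
  have d0: "d u0 = (\<lambda>v. v)" by (rule ext) (simp add: d_def PD)
  have cont: "continuous_on \<Omega> (\<lambda>u. Blinfun (d u))"
  proof (rule continuous_on_blinfun_componentwise)
    fix i :: "real^2"
    have "continuous_on \<Omega> (\<lambda>u. d u i)"
      unfolding d_def
      by (intro bounded_linear.continuous_on[OF blP] smooth_on_imp_continuous_on
          smooth_on_frechet_derivative F)
    then show "continuous_on \<Omega> (\<lambda>u. blinfun_apply (Blinfun (d u)) i)"
      using bld by (simp add: bounded_linear_Blinfun_apply cong: continuous_on_cong)
  qed
  have inv0: "id_blinfun o\<^sub>L Blinfun (d u0) = id_blinfun"
    by (rule blinfun_eqI) (simp add: d0 bounded_linear_Blinfun_apply[OF bounded_linear_ident])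
  have der: "(\<Phi> has_derivative blinfun_apply (Blinfun (d u))) (at u)" if "u \<in> \<Omega>" for u
    using D\<Phi>[OF that] by (simp add: bounded_linear_Blinfun_apply[OF bld[OF that]])
  obtain Z V \<Psi> \<Psi>' where ZV: "open Z" "Z \<subseteq> \<Omega>" "u0 \<in> Z" "open V" "\<Phi> u0 \<in> V" "homeomorphism Z V \<Phi> \<Psi>"
    and D\<Psi>: "\<And>y. y \<in> V \<Longrightarrow> (\<Psi> has_derivative \<Psi>' y) (at y)"
    by (rule inverse_function_theorem[OF open_\<Omega> der cont u0 inv0], assumption, rule that)
  have \<Phi>0: "\<Phi> u0 = 0" by (simp add: \<Phi>_def linear_0[OF P])
  show ?thesis
    using that[OF P PD Pa DP ZV(1-4) _ ZV(6)[unfolded \<Phi>_def[abs_def]]] ZV(5) \<Phi>0 D\<Psi>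
    unfolding differentiable_def by metis
qed

text \<open>In these coordinates a curve on the surface is as differentiable as its image in space.\<close>

lemma lift_differentiable:
  assumes \<epsilon>: "\<epsilon> > 0" and cont: "continuous_on {- \<epsilon><..<\<epsilon>} u" and "u 0 = u0"
    and \<gamma>: "\<And>s. s \<in> {- \<epsilon><..<\<epsilon>} \<Longrightarrow> \<gamma> s = F (u s)"
    and diff: "\<And>s. s \<in> {- \<epsilon><..<\<epsilon>} \<Longrightarrow> \<gamma> differentiable (at s)"
  shows "\<exists>w. D w = vector_derivative \<gamma> (at 0) \<and> (u has_vector_derivative w) (at 0)"
    and "\<forall>\<^sub>F s in nhds 0. n (E (u s)) \<bullet> vector_derivative \<gamma> (at s) = 0"
proof -
  obtain P Z V \<Psi> where P: "linear P" and "\<And>v. P (D v) = v" "P a = 0"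
    "\<And>z. D (P z) + (n a \<bullet> z) *\<^sub>R a = z"
    and Z: "open Z" "Z \<subseteq> \<Omega>" "u0 \<in> Z" and "open V" "0 \<in> V"
    and hom: "homeomorphism Z V (\<lambda>u. P (F u - F u0)) \<Psi>"
    and D\<Psi>: "\<And>y. y \<in> V \<Longrightarrow> \<Psi> differentiable (at y)"
    by (rule graph_coordinates, rule that)
  have blP: "bounded_linear P" using P linear_conv_bounded_linear by blast
  define J where "J = u -` Z \<inter> {- \<epsilon><..<\<epsilon>}"
  have J: "open J" using cont Z(1) continuous_on_open_vimage[OF open_greaterThanLessThan, of "- \<epsilon>" \<epsilon> u] unfolding J_def by blast
  have J0: "0 \<in> J" using \<epsilon> Z(3) \<open>u 0 = u0\<close> by (simp add: J_def)
  have *: "\<exists>w. (u has_vector_derivative w) (at s) \<and>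
      vector_derivative \<gamma> (at s) = frechet_derivative F (at (u s)) w" if s: "s \<in> J" for s
  proof -
    have us: "u r = \<Psi> (P (\<gamma> r - F u0))" if "r \<in> J" for r
      using hom that \<gamma>[of r] unfolding J_def homeomorphism_def by force
    have V: "P (\<gamma> s - F u0) \<in> V"
      using hom s \<gamma>[of s] unfolding J_def homeomorphism_def by auto
    have "(\<lambda>r. \<gamma> r - F u0) differentiable (at s)"
      using diff[of s] s unfolding J_def by (intro differentiable_diff differentiable_const) auto
    then have "(\<lambda>r. P (\<gamma> r - F u0)) differentiable (at s)"
      unfolding differentiable_def using bounded_linear.has_derivative[OF blP] by blast
    then have "(\<Psi> \<circ> (\<lambda>r. P (\<gamma> r - F u0))) differentiable (at s)"
      using D\<Psi>[OF V] by (intro differentiable_chain_at)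
    then obtain u' where "((\<lambda>r. \<Psi> (P (\<gamma> r - F u0))) has_derivative u') (at s)"
      unfolding differentiable_def o_def by blast
    then have "(u has_derivative u') (at s)"
      by (rule has_derivative_transform_within_open[OF _ J s]) (simp add: us)
    then have "u differentiable (at s)" by (rule differentiableI)
    then obtain w where w: "(u has_vector_derivative w) (at s)" using vector_derivative_works by blast
    have "u s \<in> \<Omega>" using s Z(2) by (auto simp: J_def)
    from vector_derivative_diff_chain_within[OF w, of F "frechet_derivative F (at (u s))"]
      smooth_on_has_derivative[OF F this]
    have "(F \<circ> u has_vector_derivative frechet_derivative F (at (u s)) w) (at s)"
      by (simp add: has_derivative_at_withinI)
    then have "(\<gamma> has_vector_derivative frechet_derivative F (at (u s)) w) (at s)"
      using J s \<gamma> by (intro has_vector_derivative_transform_within_open[of "F \<circ> u" _ s J \<gamma>])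
        (auto simp: J_def)
    then show ?thesis using w vector_derivative_at by blast
  qed
  show "\<exists>w. D w = vector_derivative \<gamma> (at 0) \<and> (u has_vector_derivative w) (at 0)"
    using *[OF J0] \<open>u 0 = u0\<close> by metis
  have "\<forall>s\<in>J. n (E (u s)) \<bullet> vector_derivative \<gamma> (at s) = 0"
  proof
    fix s assume s: "s \<in> J"
    then have "u s \<in> \<Omega>" using Z(2) by (auto simp: J_def)
    then show "n (E (u s)) \<bullet> vector_derivative \<gamma> (at s) = 0" using *[OF s] nF by auto
  qed
  then show "\<forall>\<^sub>F s in nhds 0. n (E (u s)) \<bullet> vector_derivative \<gamma> (at s) = 0"
    using J J0 eventually_nhds by blast
qed

text \<open>In graph coordinates the section by the plane of \<open>a\<close> and \<open>D w\<close> is the line in direction \<open>w\<close>.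
  The tangent vector of its image over \<open>w\<close> is \<open>D w\<close> plus a multiple of \<open>a\<close>, and the multiple is found
  from \<open>n (E u)\<close>; in particular the tangent vector is continuous.\<close>

lemma section_line:
  assumes w: "w \<noteq> 0"
  obtains \<delta> \<sigma> Z x where "\<delta> > 0" "\<sigma> 0 = u0"
    "open Z" "Z \<subseteq> \<Omega>" "continuous_on Z x" "\<And>s. \<bar>s\<bar> < \<delta> \<Longrightarrow> \<sigma> s \<in> Z \<and> x (\<sigma> s) = s"
    "\<And>s. \<bar>s\<bar> < \<delta> \<Longrightarrow> F (\<sigma> s) - F u0 \<in> span {a, D w}"
    "\<And>u. u \<in> Z \<Longrightarrow> F u - F u0 \<in> span {a, D w} \<Longrightarrow> \<sigma> (x u) = u"
    "\<And>s. \<bar>s\<bar> < \<delta> \<Longrightarrow> \<sigma> differentiable (at s)"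
    "\<And>s. \<bar>s\<bar> < \<delta> \<Longrightarrow> n (E (\<sigma> s)) \<bullet> a > 0"
    "\<And>s. \<bar>s\<bar> < \<delta> \<Longrightarrow> ((\<lambda>s. F (\<sigma> s)) has_vector_derivative
        D w - ((n (E (\<sigma> s)) \<bullet> D w) / (n (E (\<sigma> s)) \<bullet> a)) *\<^sub>R a) (at s)"
proof -
  obtain P Z V \<Psi> where P: "linear P" and PD: "\<And>v. P (D v) = v" and Pa: "P a = 0"
    and DP: "\<And>z. D (P z) + (n a \<bullet> z) *\<^sub>R a = z"
    and Z: "open Z" "Z \<subseteq> \<Omega>" "u0 \<in> Z" and V: "open V" "0 \<in> V"
    and hom: "homeomorphism Z V (\<lambda>u. P (F u - F u0)) \<Psi>"
    and D\<Psi>: "\<And>y. y \<in> V \<Longrightarrow> \<Psi> differentiable (at y)"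
    by (rule graph_coordinates, rule that)
  have blP: "bounded_linear P" using P linear_conv_bounded_linear by blast
  have \<Psi>Z: "\<Psi> y \<in> Z" "P (F (\<Psi> y) - F u0) = y" if "y \<in> V" for y
    using hom that unfolding homeomorphism_def by auto
  have \<Phi>V: "P (F u - F u0) \<in> V" "\<Psi> (P (F u - F u0)) = u" if "u \<in> Z" for u
    using hom that unfolding homeomorphism_def by auto
  define \<sigma> where "\<sigma> s = \<Psi> (s *\<^sub>R w)" for s
  define x where "x u = (P (F u - F u0) \<bullet> w) / (w \<bullet> w)" for u
  have \<sigma>0: "\<sigma> 0 = u0" using \<Phi>V(2)[OF Z(3)] by (simp add: \<sigma>_def linear_0[OF P])
  define J where "J = (\<lambda>s. s *\<^sub>R w) -` V"
  have J: "open J" unfolding J_def using V(1) by (intro open_vimage continuous_intros)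
  have J0: "0 \<in> J" using V(2) by (simp add: J_def)
  have \<sigma>d: "\<sigma> differentiable (at s)" if "s \<in> J" for s
    unfolding \<sigma>_def
    using differentiable_chain_at[of "\<lambda>s. s *\<^sub>R w" s \<Psi>] D\<Psi> that
    by (auto simp: o_def J_def intro!: differentiable_scaleR)
  have \<sigma>Z: "\<sigma> s \<in> Z" "P (F (\<sigma> s) - F u0) = s *\<^sub>R w" if "s \<in> J" for s
    using \<Psi>Z that unfolding J_def \<sigma>_def by auto
  have c\<sigma>: "continuous_on J (\<lambda>s. n (E (\<sigma> s)) \<bullet> a)"
  proof -
    have "continuous_on J \<sigma>"
      using \<sigma>d differentiable_imp_continuous_within by (intro continuous_at_imp_continuous_on) blast
    then have "continuous_on J (\<lambda>s. E (\<sigma> s))"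
      using continuous_on_compose2[OF smooth_on_imp_continuous_on[OF E]] \<sigma>Z(1) Z(2) by blast
    moreover have "E (\<sigma> s) \<noteq> 0" if "s \<in> J" for s using E0 \<sigma>Z(1)[OF that] Z(2) by blast
    ultimately show ?thesis by (intro continuous_intros continuous_on_n_compose)
  qed
  have "open ((\<lambda>s. n (E (\<sigma> s)) \<bullet> a) -` {0<..} \<inter> J)"
    using c\<sigma> continuous_on_open_vimage[OF J] open_greaterThan by blast
  moreover have "0 \<in> (\<lambda>s. n (E (\<sigma> s)) \<bullet> a) -` {0<..} \<inter> J"
    using J0 by (simp add: \<sigma>0 na)
  ultimately obtain \<delta> where \<delta>: "\<delta> > 0" "ball 0 \<delta> \<subseteq> (\<lambda>s. n (E (\<sigma> s)) \<bullet> a) -` {0<..} \<inter> J"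
    using open_contains_ball by blast
  have in_J: "s \<in> J" and pos: "n (E (\<sigma> s)) \<bullet> a > 0" if "\<bar>s\<bar> < \<delta>" for s
    using \<delta>(2) that by (auto simp: subset_iff dist_real_def)
  have "continuous_on Z x"
    unfolding x_def using smooth_on_imp_continuous_on[OF F] continuous_on_subset Z(2) w
    by (intro continuous_intros bounded_linear.continuous_on[OF blP]) auto
  moreover have "\<sigma> s \<in> Z \<and> x (\<sigma> s) = s" if "\<bar>s\<bar> < \<delta>" for s
    using \<sigma>Z[OF in_J[OF that]] w by (simp add: x_def)
  moreover have "F (\<sigma> s) - F u0 \<in> span {a, D w}" if "\<bar>s\<bar> < \<delta>" for s
  proof -
    have "F (\<sigma> s) - F u0 = D (s *\<^sub>R w) + (n a \<bullet> (F (\<sigma> s) - F u0)) *\<^sub>R a"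
      using DP[of "F (\<sigma> s) - F u0"] \<sigma>Z(2)[OF in_J[OF that]] by simp
    also have "\<dots> \<in> span {a, D w}"
      unfolding linear_cmul[OF linear_D] by (intro span_add span_scale) (auto intro: span_base)
    finally show ?thesis .
  qed
  moreover have "\<sigma> (x u) = u" if u: "u \<in> Z" "F u - F u0 \<in> span {a, D w}" for u
  proof -
    obtain k l where "F u - F u0 = k *\<^sub>R a + l *\<^sub>R D w"
      using u(2) by (auto simp: span_insert algebra_simps span_singleton)
    then have "P (F u - F u0) = l *\<^sub>R w" by (simp add: linear_add[OF P] linear_cmul[OF P] Pa PD)
    then have "P (F u - F u0) = x u *\<^sub>R w" using w by (simp add: x_def)
    then show ?thesis using \<Phi>V(2)[OF u(1)] by (simp add: \<sigma>_def)
  qed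
  moreover have "((\<lambda>s. F (\<sigma> s)) has_vector_derivative
        D w - ((n (E (\<sigma> s)) \<bullet> D w) / (n (E (\<sigma> s)) \<bullet> a)) *\<^sub>R a) (at s)" if s: "\<bar>s\<bar> < \<delta>" for s
  proof -
    have u\<Omega>: "\<sigma> s \<in> \<Omega>" using \<sigma>Z(1)[OF in_J[OF s]] Z(2) by blast
    obtain \<sigma>' where \<sigma>': "(\<sigma> has_vector_derivative \<sigma>') (at s)"
      using \<sigma>d[OF in_J[OF s]] vector_derivative_works by blast
    define c where "c = frechet_derivative F (at (\<sigma> s)) \<sigma>'"
    have c: "((\<lambda>s. F (\<sigma> s)) has_vector_derivative c) (at s)"
      using vector_derivative_diff_chain_within[OF \<sigma>', of F "frechet_derivative F (at (\<sigma> s))"]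
        smooth_on_has_derivative[OF F u\<Omega>]
      by (simp add: has_derivative_at_withinI o_def c_def)
    have "((\<lambda>s. P (F (\<sigma> s) - F u0)) has_vector_derivative P c) (at s)"
      using bounded_linear.has_vector_derivative[OF blP
          has_vector_derivative_diff[OF c has_vector_derivative_const[of "F u0"]]] by simp
    moreover have "((\<lambda>s. P (F (\<sigma> s) - F u0)) has_vector_derivative w) (at s)"
      by (rule has_vector_derivative_transform_within_open[of "\<lambda>s. s *\<^sub>R w" _ s J])
        (auto intro!: derivative_eq_intros simp: J in_J[OF s] \<sigma>Z(2) has_vector_derivative_def)
    ultimately have "P c = w" using vector_derivative_unique_at by blast
    then have c_eq: "c = D w + (n a \<bullet> c) *\<^sub>R a" using DP[of c] by simp
    define h where "h = n a \<bullet> c"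
    have "n (E (\<sigma> s)) \<bullet> c = 0" unfolding c_def by (rule nF[OF u\<Omega>])
    then have "n (E (\<sigma> s)) \<bullet> D w + h * (n (E (\<sigma> s)) \<bullet> a) = 0"
      unfolding h_def by (subst (asm) c_eq) (simp add: inner_add_right)
    then have "h = - ((n (E (\<sigma> s)) \<bullet> D w) / (n (E (\<sigma> s)) \<bullet> a))"
      using pos[OF s] by (simp add: field_simps)
    then show ?thesis using c c_eq unfolding h_def[symmetric] by simp
  qed
  ultimately show ?thesis
    using that[of \<delta> \<sigma> Z x] \<delta>(1) \<sigma>0 Z \<sigma>d in_J pos by blast
qed

text \<open>The curve over the line, reparametrized by arc length. The neighbourhood \<open>Z\<close> is cut down by the
  coordinate along the line so that its section is exactly the arc that is parametrized.\<close>

lemma section_curve: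
  assumes NX: "N (D w) = 1"
  obtains \<epsilon> u Z where "\<epsilon> > 0" "continuous_on {- \<epsilon><..<\<epsilon>} u" "u 0 = u0" "open Z" "Z \<subseteq> \<Omega>"
    "u ` {- \<epsilon><..<\<epsilon>} = {v \<in> Z. F v - F u0 \<in> span {a, D w}}"
    "arc_length_on N {- \<epsilon><..<\<epsilon>} (\<lambda>s. F (u s))" "vector_derivative (\<lambda>s. F (u s)) (at 0) = D w"
    "\<And>s. s \<in> {- \<epsilon><..<\<epsilon>} \<Longrightarrow> \<exists>l>0. vector_derivative (\<lambda>s. F (u s)) (at s)
        = l *\<^sub>R (D w - ((n (E (u s)) \<bullet> D w) / (n (E (u s)) \<bullet> a)) *\<^sub>R a)"
proof -
  have X0: "D w \<noteq> 0" using NX is_norm by auto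
  then have w0: "w \<noteq> 0" using linear_0[OF linear_D] by auto
  obtain \<delta> \<sigma> Z x where \<delta>: "\<delta> > 0" and \<sigma>0: "\<sigma> 0 = u0"
    and Z: "open Z" "Z \<subseteq> \<Omega>" and x: "continuous_on Z x"
    and \<sigma>Z: "\<And>s. \<bar>s\<bar> < \<delta> \<Longrightarrow> \<sigma> s \<in> Z \<and> x (\<sigma> s) = s"
    and sec: "\<And>s. \<bar>s\<bar> < \<delta> \<Longrightarrow> F (\<sigma> s) - F u0 \<in> span {a, D w}"
    and sec': "\<And>u. u \<in> Z \<Longrightarrow> F u - F u0 \<in> span {a, D w} \<Longrightarrow> \<sigma> (x u) = u"
    and \<sigma>d: "\<And>s. \<bar>s\<bar> < \<delta> \<Longrightarrow> \<sigma> differentiable (at s)"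
    and pos: "\<And>s. \<bar>s\<bar> < \<delta> \<Longrightarrow> n (E (\<sigma> s)) \<bullet> a > 0"
    and DF: "\<And>s. \<bar>s\<bar> < \<delta> \<Longrightarrow> ((\<lambda>s. F (\<sigma> s)) has_vector_derivative
        D w - ((n (E (\<sigma> s)) \<bullet> D w) / (n (E (\<sigma> s)) \<bullet> a)) *\<^sub>R a) (at s)"
    by (rule section_line[OF w0], rule that)
  define K where "K s = D w - ((n (E (\<sigma> s)) \<bullet> D w) / (n (E (\<sigma> s)) \<bullet> a)) *\<^sub>R a" for s
  \<comment> \<open>The speed is known on an interval only; it is extended to the line by constants.\<close>
  define b where "b = \<delta> / 2"
  have b: "b > 0" "b < \<delta>" using \<delta> by (simp_all add: b_def)
  define cl where "cl s = max (- b) (min b s)" for s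
  have cl_abs: "\<bar>cl s\<bar> \<le> b" for s using b(1) by (auto simp: cl_def)
  have cl_\<delta>: "\<bar>cl s\<bar> < \<delta>" for s using cl_abs[of s] b(2) by linarith
  have cl_id: "cl s = s" if "\<bar>s\<bar> \<le> b" for s using that by (auto simp: cl_def)
  have c\<sigma>: "continuous_on {- \<delta><..<\<delta>} \<sigma>"
  proof (intro continuous_at_imp_continuous_on ballI)
    fix s assume "s \<in> {- \<delta><..<\<delta>}"
    then have "\<bar>s\<bar> < \<delta>" by auto
    then show "isCont \<sigma> s" using \<sigma>d differentiable_imp_continuous_within by blast
  qed
  have cK: "continuous_on {- \<delta><..<\<delta>} K"
  proof -
    have "continuous_on {- \<delta><..<\<delta>} (\<lambda>s. E (\<sigma> s))"
      by (rule continuous_on_compose2[OF smooth_on_imp_continuous_on[OF E] c\<sigma>])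
        (use \<sigma>Z Z(2) in \<open>auto simp: abs_less_iff subset_iff\<close>)
    moreover have "E (\<sigma> s) \<noteq> 0" if "s \<in> {- \<delta><..<\<delta>}" for s
    proof -
      have "\<sigma> s \<in> \<Omega>" using \<sigma>Z[of s] Z(2) that by auto
      then show ?thesis by (rule E0)
    qed
    moreover have "n (E (\<sigma> s)) \<bullet> a \<noteq> 0" if "s \<in> {- \<delta><..<\<delta>}" for s
    proof -
      have "\<bar>s\<bar> < \<delta>" using that by auto
      then show ?thesis using pos by fastforce
    qed
    ultimately show ?thesis unfolding K_def by (intro continuous_intros continuous_on_n_compose) auto
  qed
  have cKcl: "continuous_on UNIV (\<lambda>s. K (cl s))"
  proof (rule continuous_on_compose2[OF cK])
    show "continuous_on UNIV cl" unfolding cl_def by (intro continuous_intros)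
    show "cl ` UNIV \<subseteq> {- \<delta><..<\<delta>}"
    proof (rule image_subsetI)
      show "cl s \<in> {- \<delta><..<\<delta>}" for s using cl_\<delta>[of s] by auto
    qed
  qed
  have K0: "K s \<noteq> 0" for s
  proof
    assume "K s = 0"
    then have eq: "D w = ((n (E (\<sigma> s)) \<bullet> D w) / (n (E (\<sigma> s)) \<bullet> a)) *\<^sub>R a" (is "_ = ?k *\<^sub>R a")
      by (simp add: K_def)
    have "n a \<bullet> D w = ?k * (n a \<bullet> a)" by (subst eq) simp
    then have k0: "?k = 0" using nF[OF u0, of w] na by (simp only: mult_1_right)
    show False using eq X0 unfolding k0 by simp
  qed
  define v where "v s = N (K (cl s))" for s
  have cv: "continuous_on UNIV v" unfolding v_def by (rule continuous_on_N_compose[OF cKcl])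
  have v_pos: "v s > 0" for s unfolding v_def by (rule N_pos[OF K0])
  obtain s0 where s0: "\<And>s. s \<in> {- b..b} \<Longrightarrow> v s0 \<le> v s"
    using continuous_attains_inf[of "{- b..b}" v] continuous_on_subset[OF cv, of "{- b..b}"] b(1)
    by fastforce
  have bound: "v s0 \<le> v s" for s
  proof -
    have "v (cl s) = v s" using cl_id[OF cl_abs] by (simp add: v_def)
    moreover have "cl s \<in> {- b..b}" using cl_abs[of s] by auto
    ultimately show ?thesis using s0[of "cl s"] by simp
  qed
  obtain \<theta> L where \<theta>0: "\<theta> 0 = 0" and D\<theta>: "\<And>t. (\<theta> has_real_derivative 1 / v (\<theta> t)) (at t)"
    and L: "\<And>x. isCont L x" "\<And>t. L (\<theta> t) = t" "\<And>x. \<theta> (L x) = x"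
    by (rule inverse_speed_reparametrization[OF cv v_pos bound], rule that)
  have c\<theta>: "continuous_on UNIV \<theta>"
    using D\<theta> DERIV_isCont by (intro continuous_at_imp_continuous_on) blast
  obtain \<epsilon> where \<epsilon>: "\<epsilon> > 0" and small: "\<And>s. \<bar>s\<bar> < \<epsilon> \<Longrightarrow> \<bar>\<theta> s\<bar> < b"
  proof -
    obtain d where "d > 0" "\<And>s. \<bar>s\<bar> < d \<Longrightarrow> \<bar>\<theta> s\<bar> < b"
      using c\<theta> b(1) \<theta>0 unfolding continuous_on_iff
      by (metis UNIV_I dist_real_def diff_zero)
    then show ?thesis using that by blast
  qed
  let ?J = "{- \<epsilon><..<\<epsilon>}"
  define u where "u s = \<sigma> (\<theta> s)" for s
  define I where "I = L -` ?J"
  have "open I" unfolding I_def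
    using L(1) by (intro open_vimage continuous_at_imp_continuous_on) auto
  define Z' where "Z' = x -` I \<inter> Z"
  have "open Z'" unfolding Z'_def using x \<open>open I\<close> continuous_on_open_vimage[OF Z(1)] by blast
  have \<theta>\<delta>: "\<bar>\<theta> s\<bar> < \<delta>" "\<bar>\<theta> s\<bar> \<le> b" if "s \<in> ?J" for s
  proof -
    have "\<bar>s\<bar> < \<epsilon>" using that by auto
    from small[OF this] show "\<bar>\<theta> s\<bar> < \<delta>" "\<bar>\<theta> s\<bar> \<le> b" using b(2) by linarith+
  qed
  have "continuous_on ?J u"
    unfolding u_def
  proof (rule continuous_on_compose2[OF c\<sigma> continuous_on_subset[OF c\<theta>]])
    show "\<theta> ` ?J \<subseteq> {- \<delta><..<\<delta>}"
    proof (rule image_subsetI)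
      show "\<theta> s \<in> {- \<delta><..<\<delta>}" if "s \<in> ?J" for s using \<theta>\<delta>(1)[OF that] by auto
    qed
  qed simp
  moreover have "u 0 = u0" by (simp add: u_def \<theta>0 \<sigma>0)
  moreover have "u ` ?J = {v \<in> Z'. F v - F u0 \<in> span {a, D w}}"
  proof (intro equalityI subsetI)
    fix v assume "v \<in> u ` ?J"
    then obtain s where s: "s \<in> ?J" "v = \<sigma> (\<theta> s)" by (auto simp: u_def)
    then show "v \<in> {v \<in> Z'. F v - F u0 \<in> span {a, D w}}"
      using \<sigma>Z[OF \<theta>\<delta>(1)[OF s(1)]] sec[OF \<theta>\<delta>(1)[OF s(1)]] by (simp add: Z'_def I_def L(2))
  next
    fix v assume "v \<in> {v \<in> Z'. F v - F u0 \<in> span {a, D w}}"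
    then have v: "v \<in> Z" "L (x v) \<in> ?J" "F v - F u0 \<in> span {a, D w}" by (auto simp: Z'_def I_def)
    then have "v = u (L (x v))" using sec'[of v] by (simp add: u_def L(3))
    then show "v \<in> u ` ?J" using v(2) by blast
  qed
  moreover have D: "((\<lambda>s. F (u s)) has_vector_derivative (1 / v (\<theta> s)) *\<^sub>R K (cl (\<theta> s))) (at s)"
    if s: "s \<in> ?J" for s
    using vector_diff_chain_at[OF D\<theta>[of s, unfolded has_real_derivative_iff_has_vector_derivative]
        DF[OF \<theta>\<delta>(1)[OF s]]] cl_id[OF \<theta>\<delta>(2)[OF s]]
    by (simp add: o_def u_def K_def)
  have vd: "vector_derivative (\<lambda>s. F (u s)) (at s) = (1 / v (\<theta> s)) *\<^sub>R K (cl (\<theta> s))" if "s \<in> ?J" for s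
    using D[OF that] by (rule vector_derivative_at)
  have "arc_length_on N ?J (\<lambda>s. F (u s))"
    unfolding arc_length_on_def
  proof
    have "continuous_on ?J (\<lambda>s. (1 / v (\<theta> s)) *\<^sub>R K (cl (\<theta> s)))"
    proof (intro continuous_intros)
      have "continuous_on ?J \<theta>" using c\<theta> by (rule continuous_on_subset) simp
      then show "continuous_on ?J (\<lambda>s. v (\<theta> s))" "continuous_on ?J (\<lambda>s. K (cl (\<theta> s)))"
        using continuous_on_compose2[OF cv] continuous_on_compose2[OF cKcl] by blast+
      show "\<forall>s\<in>?J. v (\<theta> s) \<noteq> 0" using v_pos less_imp_neq by metis
    qed
    then show "(\<lambda>s. F (u s)) C1_differentiable_on ?J"
      unfolding C1_differentiable_on_def
      by (intro exI[of _ "\<lambda>s. (1 / v (\<theta> s)) *\<^sub>R K (cl (\<theta> s))"] conjI ballI D)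
    show "\<forall>s\<in>?J. N (vector_derivative (\<lambda>s. F (u s)) (at s)) = 1"
    proof
      fix s assume s: "s \<in> ?J"
      show "N (vector_derivative (\<lambda>s. F (u s)) (at s)) = 1"
        unfolding vd[OF s] is_norm_scaleR[OF is_norm] using v_pos[of "\<theta> s"] by (simp add: v_def)
    qed
  qed
  moreover have "vector_derivative (\<lambda>s. F (u s)) (at 0) = D w"
  proof -
    have "K 0 = D w" by (simp add: K_def \<sigma>0 nF[OF u0])
    moreover have "v 0 = 1" using cl_id[of 0] b(1) \<open>K 0 = D w\<close> NX by (simp add: v_def)
    ultimately show ?thesis using vd[of 0] cl_id[of 0] b(1) \<epsilon> by (simp add: \<theta>0)
  qed
  moreover have "\<exists>l>0. vector_derivative (\<lambda>s. F (u s)) (at s)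
        = l *\<^sub>R (D w - ((n (E (u s)) \<bullet> D w) / (n (E (u s)) \<bullet> a)) *\<^sub>R a)" if s: "s \<in> ?J" for s
    using vd[OF s] v_pos[of "\<theta> s"] cl_id[OF \<theta>\<delta>(2)[OF s]]
    by (intro exI[of _ "1 / v (\<theta> s)"]) (simp add: K_def u_def)
  moreover have "Z' \<subseteq> \<Omega>" using Z(2) by (auto simp: Z'_def)
  ultimately show ?thesis using that \<epsilon> \<open>open Z'\<close> by blast
qed

lemma normal_plane_axes: "N (D w) = 1 \<Longrightarrow> normal_plane N n n' a (D w)"
  by unfold_locales (use NE[OF u0] nF[OF u0] in auto)

lemma section_normal_derivative:
  assumes \<epsilon>: "\<epsilon> > 0" and cont: "continuous_on {- \<epsilon><..<\<epsilon>} u" and u: "u 0 = u0"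
    and \<gamma>: "\<And>s. s \<in> {- \<epsilon><..<\<epsilon>} \<Longrightarrow> \<gamma> s = F (u s)"
    and arc: "arc_length_on N {- \<epsilon><..<\<epsilon>} \<gamma>" and X: "vector_derivative \<gamma> (at 0) = D w"
  shows "((\<lambda>s. E (u s)) has_vector_derivative DE w) (at 0)"
    and "\<forall>\<^sub>F s in nhds 0. n (E (u s)) \<bullet> vector_derivative \<gamma> (at s) = 0"
proof -
  have diff: "\<gamma> differentiable (at s)" if "s \<in> {- \<epsilon><..<\<epsilon>}" for s
    using arc that unfolding arc_length_on_def C1_differentiable_on_eq by blast
  note lift = lift_differentiable[OF \<epsilon> cont u \<gamma> diff]
  obtain w' where w': "D w' = D w" "(u has_vector_derivative w') (at 0)" using lift(1) X by auto
  then have "w' = w" using injF by (simp add: inj_eq)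
  then show "((\<lambda>s. E (u s)) has_vector_derivative DE w) (at 0)"
    using vector_derivative_diff_chain_within[of u w 0 UNIV E DE] w'(2)
      smooth_on_has_derivative[OF E u0] u
    by (simp add: o_def has_derivative_at_withinI)
  show "\<forall>\<^sub>F s in nhds 0. n (E (u s)) \<bullet> vector_derivative \<gamma> (at s) = 0" using lift(2) .
qed

lemma section_curvature_determined:
  assumes sc: "\<And>x y. x \<noteq> y \<Longrightarrow> \<not> closed_segment x y \<subseteq> unit_sphere N"
    and NX: "N (D w) = 1"
    and \<epsilon>: "\<epsilon> > 0" and cont: "continuous_on {- \<epsilon><..<\<epsilon>} u" and u: "u 0 = u0"
    and \<gamma>: "\<And>s. s \<in> {- \<epsilon><..<\<epsilon>} \<Longrightarrow> \<gamma> s = F (u s)"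
    and arc: "arc_length_on N {- \<epsilon><..<\<epsilon>} \<gamma>" and X: "vector_derivative \<gamma> (at 0) = D w"
    and k: "has_circular_curvature N a (D w) \<gamma> 0 k"
  shows "k * (n' a (D w) \<bullet> D w) = n' a (DE w) \<bullet> D w"
proof -
  interpret normal_plane N n n' a "D w" using NX by (rule normal_plane_axes)
  obtain \<phi> \<nu> t where \<phi>: "unit_circle_param N a (D w) \<phi>"
    and ev: "\<forall>\<^sub>F r in nhds 0.
        \<nu> r \<in> unit_sphere N \<inter> span {a, D w} \<and>
        birkhoff_orthogonal_in N (span {a, D w}) (\<nu> r) (span {vector_derivative \<gamma> (at r)}) \<and>
        pos_oriented a (D w) (\<nu> r) (vector_derivative \<gamma> (at r)) \<and>
        \<nu> r = \<phi> (t r) \<and> vector_derivative \<phi> (at (t r)) = vector_derivative \<gamma> (at r)"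
    and t: "(t has_real_derivative k) (at 0)"
    using k unfolding has_circular_curvature_def by blast
  note nd = section_normal_derivative[OF \<epsilon> cont u \<gamma> arc X]
  have "continuous_on {- \<epsilon><..<\<epsilon>} (\<lambda>r. vector_derivative \<gamma> (at r))"
    using arc unfolding arc_length_on_def C1_differentiable_on_eq by blast
  then have "isCont (\<lambda>r. vector_derivative \<gamma> (at r)) 0"
    using \<epsilon> by (simp add: continuous_on_eq_continuous_at)
  moreover have "\<forall>\<^sub>F r in nhds 0. vector_derivative \<phi> (at (t r)) = vector_derivative \<gamma> (at r)"
    using ev by eventually_elim blast
  ultimately show ?thesis
    using circular_curvature_determined[OF sc \<phi> nd(1) _ _ _ nd(2) _ t] X by (simp add: u)
qed

lemma section_curvature_exists:
  assumes def: "\<And>q v. N q = 1 \<Longrightarrow> v \<noteq> 0 \<Longrightarrow> n q \<bullet> v = 0 \<Longrightarrow> n' q v \<bullet> v > 0"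
    and NX: "N (D w) = 1"
    and \<epsilon>: "\<epsilon> > 0" and cont: "continuous_on {- \<epsilon><..<\<epsilon>} u" and u: "u 0 = u0"
    and arc: "arc_length_on N {- \<epsilon><..<\<epsilon>} (\<lambda>s. F (u s))"
    and X: "vector_derivative (\<lambda>s. F (u s)) (at 0) = D w"
    and dir: "\<And>s. s \<in> {- \<epsilon><..<\<epsilon>} \<Longrightarrow> \<exists>l>0. vector_derivative (\<lambda>s. F (u s)) (at s)
        = l *\<^sub>R (D w - ((n (E (u s)) \<bullet> D w) / (n (E (u s)) \<bullet> a)) *\<^sub>R a)"
  shows "\<exists>k. has_circular_curvature N a (D w) (\<lambda>s. F (u s)) 0 k"
proof -
  interpret normal_plane N n n' a "D w" using NX by (rule normal_plane_axes)
  have near: "\<forall>\<^sub>F s in nhds 0. s \<in> {- \<epsilon><..<\<epsilon>}"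
    using \<epsilon> by (intro eventually_nhds_in_open) auto
  show ?thesis
  proof (rule circular_curvature_exists[OF def])
    show "((\<lambda>s. E (u s)) has_vector_derivative DE w) (at 0)"
      by (rule section_normal_derivative(1)[OF \<epsilon> cont u _ arc X]) simp
    show "E (u 0) = a" by (simp add: u)
    show "\<forall>\<^sub>F r in nhds 0. N (vector_derivative (\<lambda>s. F (u s)) (at r)) = 1"
      using near by eventually_elim (use arc in \<open>simp add: arc_length_on_def\<close>)
    show "\<forall>\<^sub>F r in nhds 0. \<exists>l>0. vector_derivative (\<lambda>s. F (u s)) (at r)
        = l *\<^sub>R (D w - ((n (E (u r)) \<bullet> D w) / (n (E (u r)) \<bullet> a)) *\<^sub>R a)"
      using near by eventually_elim (rule dir)
  qed
qed

end

section \<open>Charts\<close>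

lemma smooth_on_subset:
  assumes "smooth_on S f" "T \<subseteq> S"
  shows "smooth_on T f"
proof -
  have "Ck_on k S f \<Longrightarrow> Ck_on k T f" for k and f :: "'a \<Rightarrow> 'b"
    using assms(2) by (induction k arbitrary: f) (auto intro: continuous_on_subset)
  then show ?thesis using assms(1) by (auto simp: smooth_on_def)
qed

locale surface_chart =
  fixes M :: "'m topology" and A :: "'m atlas" and U :: "'m set" and \<psi> :: "'m \<Rightarrow> real^2"
  assumes surface: "smooth_surface M A" and chart: "(U, \<psi>) \<in> A"
begin

lemma openin_U: "openin M U" and open_image: "open (\<psi> ` U)"
  and homeo: "homeomorphic_map (subtopology M U) (top_of_set (\<psi> ` U)) \<psi>"
  using surface chart unfolding smooth_surface_def by auto

lemma topspace_U: "topspace (subtopology M U) = U"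
  using openin_subset[OF openin_U] by auto

lemma inj_chart: "inj_on \<psi> U"
  using homeo unfolding homeomorphic_eq_everything_map topspace_U by blast

lemma inv_chart [simp]: "q \<in> U \<Longrightarrow> inv_into U \<psi> (\<psi> q) = q"
  using inj_chart by (rule inv_into_f_f)

lemma open_chart_image:
  assumes "openin M V"
  shows "open (\<psi> ` (U \<inter> V))"
proof -
  have "openin (subtopology M U) (U \<inter> V)"
    using assms by (simp add: openin_subtopology_Int2)
  then have "openin (top_of_set (\<psi> ` U)) (\<psi> ` (U \<inter> V))"
    using homeo unfolding homeomorphic_eq_everything_map open_map_def by blast
  then show ?thesis using open_image openin_open_trans by blast
qed

lemma openin_chart_vimage:
  assumes "open B"
  shows "openin M {q \<in> U. \<psi> q \<in> B}"
proof -
  have "continuous_map (subtopology M U) (top_of_set (\<psi> ` U)) \<psi>"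
    using homeo unfolding homeomorphic_eq_everything_map by blast
  moreover have "openin (top_of_set (\<psi> ` U)) (\<psi> ` U \<inter> B)" using assms by (simp add: openin_open_Int)
  ultimately have "openin (subtopology M U) {q \<in> topspace (subtopology M U). \<psi> q \<in> \<psi> ` U \<inter> B}"
    by (rule openin_continuous_map_preimage)
  moreover have "{q \<in> topspace (subtopology M U). \<psi> q \<in> \<psi> ` U \<inter> B} = {q \<in> U. \<psi> q \<in> B}"
    unfolding topspace_U by blast
  ultimately show ?thesis using openin_U openin_trans_full by metis
qed

lemma continuous_chart_compose:
  assumes c: "continuous_map (top_of_set J) M c" and J: "T \<subseteq> J" "c ` T \<subseteq> U"
  shows "continuous_on T (\<lambda>s. \<psi> (c s))"
proof -
  have "continuous_map (top_of_set T) M c"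
    using c J(1) by (metis continuous_map_from_subtopology_mono)
  then have "continuous_map (top_of_set T) (subtopology M U) c"
    using J(2) by (simp add: continuous_map_in_subtopology image_subset_iff)
  moreover have "continuous_map (subtopology M U) (top_of_set (\<psi> ` U)) \<psi>"
    using homeo unfolding homeomorphic_eq_everything_map by blast
  ultimately have "continuous_map (top_of_set T) (top_of_set (\<psi> ` U)) (\<psi> \<circ> c)"
    by (rule continuous_map_compose)
  then have "continuous_map (top_of_set T) euclidean (\<psi> \<circ> c)"
    by (simp add: continuous_map_in_subtopology)
  then show ?thesis by (simp add: o_def)
qed

lemma continuous_inverse_chart_compose:
  assumes u: "continuous_on J u" "u ` J \<subseteq> \<psi> ` U"
  shows "continuous_map (top_of_set J) M (\<lambda>s. inv_into U \<psi> (u s))"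
proof -
  obtain g where g: "homeomorphic_maps (subtopology M U) (top_of_set (\<psi> ` U)) \<psi> g"
    using homeo homeomorphic_map_maps by blast
  then have cg: "continuous_map (top_of_set (\<psi> ` U)) M g"
    unfolding homeomorphic_maps_def by (metis continuous_map_in_subtopology)
  have "continuous_map (top_of_set J) (top_of_set (\<psi> ` U)) u"
    using u by (simp add: continuous_map_in_subtopology image_subset_iff)
  from continuous_map_compose[OF this cg] have "continuous_map (top_of_set J) M (g \<circ> u)" .
  moreover have "(g \<circ> u) s = inv_into U \<psi> (u s)" if "s \<in> J" for s
  proof -
    have "u s \<in> \<psi> ` U" using u(2) that by (rule subsetD[OF _ imageI])
    then obtain q where q: "q \<in> U" "u s = \<psi> q" by (elim imageE) simp
    have "g (\<psi> q) = q" using g q(1) unfolding homeomorphic_maps_def topspace_U by blast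
    then show ?thesis using q by simp
  qed
  ultimately show ?thesis by (rule continuous_map_eq) simp
qed

text \<open>The tangent plane at \<open>q\<close> is defined by a chart chosen at \<open>q\<close>, which may differ from the chart that is
  used in a neighbourhood of another point; the transition map relates the two.\<close>

lemma range_chart_derivative:
  assumes f: "smooth_map_on A (topspace M) f" and q: "q \<in> U"
  shows "range (frechet_derivative (f \<circ> inv_into U \<psi>) (at (\<psi> q))) \<subseteq> tangent_plane A f q"
proof -
  obtain V \<theta> where V: "chart_at A q = (V, \<theta>)" by fastforce
  have "\<exists>c. c \<in> A \<and> q \<in> fst c" using chart q by force
  then have "chart_at A q \<in> A \<and> q \<in> fst (chart_at A q)" unfolding chart_at_def by (rule someI_ex)
  then have VA: "(V, \<theta>) \<in> A" and qV: "q \<in> V" by (auto simp: V)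
  interpret V: surface_chart M A V \<theta> using surface VA by unfold_locales
  have "V \<subseteq> topspace M" using openin_subset[OF V.openin_U] .
  then have "\<theta> ` (V \<inter> topspace M) = \<theta> ` V" by (simp add: Int_absorb2)
  then have sG: "smooth_on (\<theta> ` V) (f \<circ> inv_into V \<theta>)"
    using f VA unfolding smooth_map_on_def by force
  have s\<tau>: "smooth_on (\<psi> ` (U \<inter> V)) (\<theta> \<circ> inv_into U \<psi>)"
  proof -
    have "\<forall>c\<in>A. \<forall>d\<in>A. smooth_on (snd c ` (fst c \<inter> fst d)) (snd d \<circ> inv_into (fst c) (snd c))"
      using surface unfolding smooth_surface_def split_def by (elim conjE)
    from bspec[OF bspec[OF this chart] VA] show ?thesis by simp
  qed
  let ?G' = "frechet_derivative (f \<circ> inv_into V \<theta>) (at (\<theta> q))"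
  let ?\<tau>' = "frechet_derivative (\<theta> \<circ> inv_into U \<psi>) (at (\<psi> q))"
  have \<tau>: "(\<theta> \<circ> inv_into U \<psi> has_derivative ?\<tau>') (at (\<psi> q))"
    using smooth_on_has_derivative[OF s\<tau>] q qV by blast
  have G: "(f \<circ> inv_into V \<theta> has_derivative ?G') (at ((\<theta> \<circ> inv_into U \<psi>) (\<psi> q)))"
    using smooth_on_has_derivative[OF sG, of "\<theta> q"] q qV by simp
  have "((f \<circ> inv_into V \<theta>) \<circ> (\<theta> \<circ> inv_into U \<psi>) has_derivative ?G' \<circ> ?\<tau>') (at (\<psi> q))"
    by (rule diff_chain_at[OF \<tau> G])
  then have "(f \<circ> inv_into U \<psi> has_derivative ?G' \<circ> ?\<tau>') (at (\<psi> q))"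
    by (rule has_derivative_transform_within_open[OF _ open_chart_image[OF V.openin_U]])
      (use q qV in auto)
  then have "frechet_derivative (f \<circ> inv_into U \<psi>) (at (\<psi> q)) = ?G' \<circ> ?\<tau>'"
    using frechet_derivative_at by metis
  then show ?thesis unfolding tangent_plane_def differential_def V by auto
qed

end

context smooth_norm begin

text \<open>The functional of a supporting plane at \<open>v\<close>, normalized to the value \<open>1\<close> at \<open>v\<close>, is the gradient.\<close>

lemma birkhoff_orthogonal_normal:
  assumes b: "birkhoff_orthogonal_in N UNIV v P" and v: "N v = 1" and y: "y \<in> P"
  shows "n v \<bullet> y = 0"
proof -
  obtain m where m: "m \<noteq> 0" "\<And>y. y \<in> P \<Longrightarrow> m \<bullet> y = 0" "\<And>y. N y \<le> 1 \<Longrightarrow> m \<bullet> y \<le> m \<bullet> v"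
    using b v unfolding birkhoff_orthogonal_in_def unit_ball_def by auto
  have v0: "v \<noteq> 0" using v is_norm by auto
  have le: "m \<bullet> z \<le> N z * (m \<bullet> v)" for z
  proof (cases "z = 0")
    case False
    have "m \<bullet> (z /\<^sub>R N z) \<le> m \<bullet> v"
      using is_norm_normalize[OF is_norm False] by (intro m(3)) linarith
    then show ?thesis using N_pos[OF False] by (simp add: divide_simps mult.commute)
  qed (simp add: is_norm)
  have "0 < N m * (m \<bullet> v)" using le[of m] m(1) by (smt (verit) inner_gt_zero_iff)
  then have mv: "m \<bullet> v > 0" using N_pos[OF m(1)] by (simp add: zero_less_mult_iff)
  have "supports N (m /\<^sub>R (m \<bullet> v)) v"
    unfolding supports_def using le mv v by (simp add: divide_simps mult.commute)
  then have "n v = m /\<^sub>R (m \<bullet> v)" using supports_unique[OF v0] by simp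
  then show ?thesis using m(2)[OF y] by simp
qed

end

section \<open>Normal curvature as a Rayleigh quotient\<close>

locale surface_in_smooth_norm = smooth_norm + surface_chart M A U \<psi>
  for M :: "'m topology" and A U \<psi> +
  fixes f \<eta> :: "'m \<Rightarrow> real^3" and W :: "'m set" and p :: 'm
  assumes f: "immersed_surface M A f" and \<eta>: "birkhoff_normal_field N M A f W \<eta>" and p: "p \<in> W"
    and chart_p: "chart_at A p = (U, \<psi>)" "p \<in> U"
begin

lemma W: "openin M W" and smooth_\<eta>: "smooth_map_on A W \<eta>"
  and \<eta>N: "q \<in> W \<Longrightarrow> N (\<eta> q) = 1"
  and \<eta>b: "q \<in> W \<Longrightarrow> birkhoff_orthogonal_in N UNIV (\<eta> q) (tangent_plane A f q)"
  using \<eta> unfolding birkhoff_normal_field_def unit_sphere_def by auto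

abbreviation "F \<equiv> f \<circ> inv_into U \<psi>"
abbreviation "E \<equiv> \<eta> \<circ> inv_into U \<psi>"

lemma differential_p: "differential A g p = frechet_derivative (g \<circ> inv_into U \<psi>) (at (\<psi> p))"
  by (simp add: differential_def chart_p)

sublocale patch: birkhoff_patch N n n' F E "\<psi> ` (U \<inter> W)" "\<psi> p"
proof
  show "open (\<psi> ` (U \<inter> W))" using W by (rule open_chart_image)
  show "\<psi> p \<in> \<psi> ` (U \<inter> W)" using p chart_p(2) by blast
  have "smooth_on (\<psi> ` (U \<inter> topspace M)) F"
    using f chart unfolding immersed_surface_def smooth_map_on_def by blast
  then show "smooth_on (\<psi> ` (U \<inter> W)) F"
    by (rule smooth_on_subset) (use openin_subset[OF W] in blast)
  show "smooth_on (\<psi> ` (U \<inter> W)) E"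
    using smooth_\<eta> chart unfolding smooth_map_on_def by blast
  show "N (E u) = 1" if "u \<in> \<psi> ` (U \<inter> W)" for u using that \<eta>N by auto
  show "n (E u) \<bullet> frechet_derivative F (at u) v = 0" if u: "u \<in> \<psi> ` (U \<inter> W)" for u v
  proof -
    obtain q where q: "q \<in> U" "q \<in> W" "u = \<psi> q" using u by blast
    have "frechet_derivative F (at u) v \<in> tangent_plane A f q"
      using range_chart_derivative[OF _ q(1)] f q(3) unfolding immersed_surface_def by blast
    then show ?thesis
      using birkhoff_orthogonal_normal[OF \<eta>b[OF q(2)] \<eta>N[OF q(2)]] q by simp
  qed
  have "p \<in> topspace M" using p openin_subset[OF W] by blast
  then show "inj (frechet_derivative F (at (\<psi> p)))"
    using f unfolding immersed_surface_def differential_p[symmetric] by blast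
qed

lemma E_p: "E (\<psi> p) = \<eta> p" and F_p: "F (\<psi> p) = f p"
  using chart_p(2) by simp_all

lemma principal_direction_iff:
  "principal_direction A f \<eta> p l (patch.D v) \<longleftrightarrow> v \<noteq> 0 \<and> patch.DE v = l *\<^sub>R patch.D v"
proof -
  have "inv patch.D (patch.D v) = v" using patch.injF by (rule inv_f_f)
  moreover have "patch.D v = 0 \<longleftrightarrow> v = 0"
    using linear_injective_0[OF patch.linear_D] patch.injF linear_0[OF patch.linear_D] by metis
  ultimately show ?thesis
    unfolding principal_direction_def tangent_plane_def shape_operator_def differential_p by auto
qed

lemma normal_section_exists:
  assumes NX: "N (patch.D w) = 1"
    and def: "\<And>q v. N q = 1 \<Longrightarrow> v \<noteq> 0 \<Longrightarrow> n q \<bullet> v = 0 \<Longrightarrow> n' q v \<bullet> v > 0"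
  shows "\<exists>\<gamma> k. normal_section N M f \<eta> p (patch.D w) \<gamma> \<and>
    has_circular_curvature N (\<eta> p) (patch.D w) \<gamma> 0 k"
proof -
  obtain \<epsilon> u Z where \<epsilon>: "\<epsilon> > 0" and u: "continuous_on {- \<epsilon><..<\<epsilon>} u" "u 0 = \<psi> p"
    and Z: "open Z" "Z \<subseteq> \<psi> ` (U \<inter> W)"
    and img: "u ` {- \<epsilon><..<\<epsilon>} = {v \<in> Z. F v - F (\<psi> p) \<in> span {E (\<psi> p), patch.D w}}"
    and arc: "arc_length_on N {- \<epsilon><..<\<epsilon>} (\<lambda>s. F (u s))" "vector_derivative (\<lambda>s. F (u s)) (at 0) = patch.D w"
    and dir: "\<And>s. s \<in> {- \<epsilon><..<\<epsilon>} \<Longrightarrow> \<exists>l>0. vector_derivative (\<lambda>s. F (u s)) (at s)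
        = l *\<^sub>R (patch.D w - ((n (E (u s)) \<bullet> patch.D w) / (n (E (u s)) \<bullet> E (\<psi> p))) *\<^sub>R E (\<psi> p))"
    by (rule patch.section_curve[OF NX], rule that)
  let ?J = "{- \<epsilon><..<\<epsilon>}"
  define c where "c s = inv_into U \<psi> (u s)" for s
  define V where "V = {q \<in> U. \<psi> q \<in> Z}"
  have uZ: "u ` ?J \<subseteq> Z" using img by blast
  have "openin M V" unfolding V_def using Z(1) by (rule openin_chart_vimage)
  moreover have "p \<in> V" using uZ u(2) \<epsilon> chart_p(2) by (force simp: V_def)
  moreover have "continuous_map (top_of_set ?J) M c"
    unfolding c_def by (rule continuous_inverse_chart_compose[OF u(1)]) (use uZ Z(2) in blast)
  moreover have "c 0 = p" using chart_p(2) by (simp add: c_def u(2))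
  moreover have "c ` ?J = {q \<in> V. f q - f p \<in> span {\<eta> p, patch.D w}}"
  proof -
    have "c ` ?J = inv_into U \<psi> ` u ` ?J" by (simp add: c_def image_image)
    also have "\<dots> = {q \<in> V. f q - f p \<in> span {\<eta> p, patch.D w}}"
      unfolding img E_p F_p
    proof (intro equalityI subsetI)
      fix q assume "q \<in> inv_into U \<psi> ` {v \<in> Z. F v - f p \<in> span {\<eta> p, patch.D w}}"
      then obtain v where v: "v \<in> Z" "F v - f p \<in> span {\<eta> p, patch.D w}" "q = inv_into U \<psi> v" by blast
      obtain q' where q': "q' \<in> U" "v = \<psi> q'" using v(1) Z(2) by blast
      then show "q \<in> {q \<in> V. f q - f p \<in> span {\<eta> p, patch.D w}}" using v by (simp add: V_def)
    next
      fix q assume "q \<in> {q \<in> V. f q - f p \<in> span {\<eta> p, patch.D w}}"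
      then have "q = inv_into U \<psi> (\<psi> q)" "\<psi> q \<in> {v \<in> Z. F v - f p \<in> span {\<eta> p, patch.D w}}"
        by (auto simp: V_def)
      then show "q \<in> inv_into U \<psi> ` {v \<in> Z. F v - f p \<in> span {\<eta> p, patch.D w}}" by (rule image_eqI)
    qed
    finally show ?thesis .
  qed
  moreover have "\<forall>s\<in>?J. F (u s) = f (c s)" by (simp add: c_def)
  ultimately have "normal_section N M f \<eta> p (patch.D w) (\<lambda>s. F (u s))"
    unfolding normal_section_def using \<epsilon> arc by blast
  moreover have "\<exists>k. has_circular_curvature N (\<eta> p) (patch.D w) (\<lambda>s. F (u s)) 0 k"
    using patch.section_curvature_exists[OF def NX \<epsilon> u arc dir] unfolding E_p by blast
  ultimately show ?thesis by blast
qed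

text \<open>A given normal section need not stay in the chart, so it is first restricted to a short interval.\<close>

lemma normal_section_curvature:
  assumes sc: "\<And>x y. x \<noteq> y \<Longrightarrow> \<not> closed_segment x y \<subseteq> unit_sphere N"
    and NX: "N (patch.D w) = 1"
    and sec: "normal_section N M f \<eta> p (patch.D w) \<gamma>"
    and k: "has_circular_curvature N (\<eta> p) (patch.D w) \<gamma> 0 k"
  shows "k * (n' (\<eta> p) (patch.D w) \<bullet> patch.D w) = n' (\<eta> p) (patch.DE w) \<bullet> patch.D w"
proof -
  obtain \<epsilon> c where \<epsilon>: "\<epsilon> > 0" and c: "continuous_map (top_of_set {- \<epsilon><..<\<epsilon>}) M c" "c 0 = p"
    and \<gamma>: "\<forall>s\<in>{- \<epsilon><..<\<epsilon>}. \<gamma> s = f (c s)"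
    and arc: "arc_length_on N {- \<epsilon><..<\<epsilon>} \<gamma>" and X: "vector_derivative \<gamma> (at 0) = patch.D w"
    using sec unfolding normal_section_def by blast
  have "openin (top_of_set {- \<epsilon><..<\<epsilon>}) {s \<in> {- \<epsilon><..<\<epsilon>}. c s \<in> U}"
    using openin_continuous_map_preimage[OF c(1) openin_U] by simp
  then have "open {s \<in> {- \<epsilon><..<\<epsilon>}. c s \<in> U}"
    using openin_open_trans open_greaterThanLessThan by blast
  moreover have "0 \<in> {s \<in> {- \<epsilon><..<\<epsilon>}. c s \<in> U}" using \<epsilon> c(2) chart_p(2) by simp
  ultimately obtain d where d: "d > 0" "ball 0 d \<subseteq> {s \<in> {- \<epsilon><..<\<epsilon>}. c s \<in> U}"
    using open_contains_ball by blast
  have ball: "ball (0::real) d = {- d<..<d}" by (simp add: ball_eq_greaterThanLessThan)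
  have sub: "{- d<..<d} \<subseteq> {- \<epsilon><..<\<epsilon>}" "c ` {- d<..<d} \<subseteq> U" using d(2) unfolding ball by blast+
  have arc': "arc_length_on N {- d<..<d} \<gamma>"
    using arc sub(1) C1_differentiable_on_subset unfolding arc_length_on_def by blast
  have \<gamma>F: "\<gamma> s = F (\<psi> (c s))" if "s \<in> {- d<..<d}" for s
  proof -
    have "c s \<in> U" "s \<in> {- \<epsilon><..<\<epsilon>}" using sub that by blast+
    then show ?thesis using \<gamma> by simp
  qed
  have "k * (n' (E (\<psi> p)) (patch.D w) \<bullet> patch.D w) = n' (E (\<psi> p)) (patch.DE w) \<bullet> patch.D w"
    by (rule patch.section_curvature_determined[OF sc NX d(1)
        continuous_chart_compose[OF c(1) sub] _ \<gamma>F arc' X]) (use c(2) k chart_p(2) in simp_all)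
  then show ?thesis unfolding E_p .
qed

end


theorem theorem5p2:
  fixes N :: "real^3 \<Rightarrow> real" and M :: "'m topology" and A :: "'m atlas"
    and f \<eta> :: "'m \<Rightarrow> real^3" and W :: "'m set" and p :: 'm and \<kappa>\<^sub>1 \<kappa>\<^sub>2 :: real
  assumes "admissible_norm N"
    and "immersed_surface M A f"
    and "birkhoff_normal_field N M A f W \<eta>"
    and "p \<in> W"
    and "\<kappa>\<^sub>1 \<ge> \<kappa>\<^sub>2" and "principal_curvatures A f \<eta> p = {\<kappa>\<^sub>1, \<kappa>\<^sub>2}"
  shows "\<forall>V \<in> tangent_plane A f p - {0}.
           \<kappa>\<^sub>2 \<le> normal_curvature N M f \<eta> p V \<and> normal_curvature N M f \<eta> p V \<le> \<kappa>\<^sub>1 \<and>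
           (normal_curvature N M f \<eta> p V = \<kappa>\<^sub>1 \<longrightarrow> principal_direction A f \<eta> p \<kappa>\<^sub>1 V) \<and>
           (normal_curvature N M f \<eta> p V = \<kappa>\<^sub>2 \<longrightarrow> principal_direction A f \<eta> p \<kappa>\<^sub>2 V)"
proof
  fix V assume V: "V \<in> tangent_plane A f p - {0}"
  have N: "is_norm N" and graph: "locally_smooth_graph (unit_sphere N)"
    and sc: "\<And>x y. x \<noteq> y \<Longrightarrow> \<not> closed_segment x y \<subseteq> unit_sphere N"
    and K: "\<And>q. N q = 1 \<Longrightarrow> \<exists>K>0. has_gauss_curvature (unit_sphere N) q K"
    using assms(1) unfolding admissible_norm_def unit_sphere_def by auto
  obtain n n' where "smooth_norm N n n'" using smooth_norm_exists[OF N graph] .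
  then interpret smooth_norm N n n' .
  obtain U \<psi> where U: "chart_at A p = (U, \<psi>)" by fastforce
  have surface: "smooth_surface M A" using assms(2) by (simp add: immersed_surface_def)
  have "p \<in> topspace M"
    using assms(3,4) openin_subset unfolding birkhoff_normal_field_def by blast
  then have "\<exists>c. c \<in> A \<and> p \<in> fst c" using surface unfolding smooth_surface_def by force
  then have "chart_at A p \<in> A \<and> p \<in> fst (chart_at A p)" unfolding chart_at_def by (rule someI_ex)
  then interpret surface_in_smooth_norm N n n' M A U \<psi> f \<eta> W p
    using U surface assms(2-4) by unfold_locales auto
  let ?D = "patch.D" and ?DE = "patch.DE"
  have \<eta>p: "N (\<eta> p) = 1" "\<eta> p \<noteq> 0" using \<eta>N[OF p] N by auto
  have def: "n' q v \<bullet> v > 0" if "N q = 1" "v \<noteq> 0" "n q \<bullet> v = 0" for q v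
    using K[OF that(1)] n'_symmetric_definite(2) that(2,3) by blast
  have nD: "n (\<eta> p) \<bullet> ?D v = 0" and nDE: "n (\<eta> p) \<bullet> ?DE v = 0" for v
    using patch.nF[OF patch.u0, of v] patch.nDE[of v] unfolding E_p by blast+
  define P where "P v w = n' (\<eta> p) (?DE v) \<bullet> ?D w" for v w
  define Q where "Q v w = n' (\<eta> p) (?D v) \<bullet> ?D w" for v w
  note lin = linear_add[OF patch.linear_D] linear_cmul[OF patch.linear_D]
    linear_add[OF patch.linear_DE] linear_cmul[OF patch.linear_DE]
    linear_add[OF n'_linear[OF \<eta>p(2)]] linear_cmul[OF n'_linear[OF \<eta>p(2)]]
  have P: "bilinear P" "P v w = P w v" for v w
    using patch.shape_symmetric[of v w] unfolding P_def E_p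
    by (auto simp: bilinear_def lin inner_add_left inner_add_right intro!: linearI)
  have Q: "bilinear Q" "Q v w = Q w v" for v w
  proof -
    obtain K where "K > 0" "has_gauss_curvature (unit_sphere N) (\<eta> p) K" using K \<eta>p(1) by blast
    then show "Q v w = Q w v" unfolding Q_def using n'_symmetric_definite(1) nD by blast
    show "bilinear Q"
      unfolding Q_def by (auto simp: bilinear_def lin inner_add_left inner_add_right intro!: linearI)
  qed
  have D0: "?D v = 0 \<longleftrightarrow> v = 0" for v
    using linear_injective_0[OF patch.linear_D] patch.injF linear_0[OF patch.linear_D] by metis
  have Qpos: "Q v v > 0" if "v \<noteq> 0" for v
    unfolding Q_def using def[OF \<eta>p(1)] nD D0 that by blast
  have eigen: "(\<forall>v. P w v = l * Q w v) \<longleftrightarrow> ?DE w = l *\<^sub>R ?D w" for l w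
  proof
    assume *: "\<forall>v. P w v = l * Q w v"
    have "?DE w - l *\<^sub>R ?D w \<in> range ?D"
      unfolding patch.range_D E_p by (simp add: inner_diff_right nD nDE)
    then obtain v where v: "?DE w - l *\<^sub>R ?D w = ?D v" by blast
    have "Q v v = P w v - l * Q w v"
      unfolding P_def Q_def v[symmetric]
      by (simp add: linear_diff[OF n'_linear[OF \<eta>p(2)]] lin inner_diff_left)
    then have "v = 0" using * Qpos[of v] by force
    then show "?DE w = l *\<^sub>R ?D w" using v D0[of v] by simp
  next
    assume "?DE w = l *\<^sub>R ?D w"
    then show "\<forall>v. P w v = l * Q w v" by (simp add: P_def Q_def lin)
  qed
  \<comment> \<open>The eigenvalues of the pair \<open>(P, Q)\<close> are the principal curvatures.\<close>
  have spectrum: "{l. \<exists>w. w \<noteq> 0 \<and> (\<forall>v. P w v = l * Q w v)} = {\<kappa>\<^sub>1, \<kappa>\<^sub>2}"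
  proof -
    have "(\<exists>w. principal_direction A f \<eta> p l w) \<longleftrightarrow> (\<exists>v. principal_direction A f \<eta> p l (?D v))" for l
      unfolding principal_direction_def tangent_plane_def differential_p by blast
    then show ?thesis
      unfolding assms(6)[symmetric] principal_curvatures_def eigen principal_direction_iff by simp
  qed
  obtain v where v: "V = ?D v" "v \<noteq> 0"
    using V D0 unfolding tangent_plane_def differential_p by blast
  define w where "w = v /\<^sub>R N V"
  have NV: "N V > 0" using V N_pos by blast
  have X: "V /\<^sub>R N V = ?D w" by (simp add: w_def v(1) lin)
  have NX: "N (?D w) = 1" using is_norm_normalize[OF N, of V] V unfolding X by simp
  \<comment> \<open>The quotient does not change when \<open>V\<close> is replaced by the unit vector in its direction.\<close>
  have k_eq: "normal_curvature N M f \<eta> p V = P v v / Q v v"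
    unfolding normal_curvature_def Let_def X
  proof (rule the_equality)
    have ratio: "k = P v v / Q v v"
      if k: "normal_section N M f \<eta> p (?D w) \<gamma>" "has_circular_curvature N (\<eta> p) (?D w) \<gamma> 0 k"
      for \<gamma> k
    proof -
      have "k * Q w w = P w w"
        using normal_section_curvature[OF sc NX k] by (simp add: P_def Q_def)
      then have "k * Q v v = P v v"
        using NV unfolding w_def by (simp add: P_def Q_def lin)
      then show ?thesis using Qpos[OF v(2)] by (simp add: field_simps)
    qed
    then show "\<exists>\<gamma>. normal_section N M f \<eta> p (?D w) \<gamma> \<and>
        has_circular_curvature N (\<eta> p) (?D w) \<gamma> 0 (P v v / Q v v)"
      using normal_section_exists[OF NX def] by metis
    show "k = P v v / Q v v" if "\<exists>\<gamma>. normal_section N M f \<eta> p (?D w) \<gamma> \<and>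
        has_circular_curvature N (\<eta> p) (?D w) \<gamma> 0 k" for k
      using ratio that by blast
  qed
  note R = Rayleigh_quotient_bounds[OF P Q Qpos spectrum assms(5) v(2)]
  have Qv: "Q v v > 0" using Qpos v(2) .
  have "\<kappa>\<^sub>2 \<le> P v v / Q v v" "P v v / Q v v \<le> \<kappa>\<^sub>1"
    using R(1,2) Qv by (simp_all add: pos_le_divide_eq pos_divide_le_eq)
  moreover have "principal_direction A f \<eta> p \<kappa>\<^sub>1 V" if "P v v / Q v v = \<kappa>\<^sub>1"
  proof -
    have "P v v = \<kappa>\<^sub>1 * Q v v" using that Qv by (simp add: field_simps)
    then have "?DE v = \<kappa>\<^sub>1 *\<^sub>R ?D v" using R(3) eigen by blast
    then show ?thesis unfolding v(1) principal_direction_iff using v(2) by blast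
  qed
  moreover have "principal_direction A f \<eta> p \<kappa>\<^sub>2 V" if "P v v / Q v v = \<kappa>\<^sub>2"
  proof -
    have "P v v = \<kappa>\<^sub>2 * Q v v" using that Qv by (simp add: field_simps)
    then have "?DE v = \<kappa>\<^sub>2 *\<^sub>R ?D v" using R(4) eigen by blast
    then show ?thesis unfolding v(1) principal_direction_iff using v(2) by blast
  qed
  ultimately show "\<kappa>\<^sub>2 \<le> normal_curvature N M f \<eta> p V \<and> normal_curvature N M f \<eta> p V \<le> \<kappa>\<^sub>1 \<and>
      (normal_curvature N M f \<eta> p V = \<kappa>\<^sub>1 \<longrightarrow> principal_direction A f \<eta> p \<kappa>\<^sub>1 V) \<and>
      (normal_curvature N M f \<eta> p V = \<kappa>\<^sub>2 \<longrightarrow> principal_direction A f \<eta> p \<kappa>\<^sub>2 V)"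
    unfolding k_eq by blast
qed

end
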